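(* Let $0<r\le 1/2$ and let $\{f_0,f_1\}$ be an IFS on $[0,1]$ as in the context, with $F_m$, $X_L$, $\pi$ and $\rho_L$ defined there. For an integer $m\ge 3$, let $L$ be the integer such that $m\in\{2^{L+1}-1,2^{L+1},\dots,2^{L+2}-2\}$. Then $$\pi^{-1}[F_m]=\{\mathbf j=(j_1,j_2,\dots)\in X_L:\ j_1=j_2=\dots=j_L=0\}.$$ Consequently, $$\dim_H F_m=\frac{\log\rho_L}{-\log r}.$$
   Context: IFS: $f_i:[0,1]\to[0,1]$, $f_i(x)=rx+b_i$ for $i=0,1$, with $f_0((0,1))\cap f_1((0,1))=\emptyset$ and $f_0([0,1])$ to the left of $f_1([0,1])$; $C$ is its attractor (the unique nonempty compact set with $C=f_0(C)\cup f_1(C)$). Tree: let $\mathcal I^*$ be the set of all finite words over $\{1,2\}$, including the empty word, and $\mathcal I=\{1,2\}^{\mathbb N}$. Order $\mathcal I^*$ by: $\mathbf i<_*\mathbf j$ if $\mathbf i$ is shorter than $\mathbf j$, or if they have equal length and $\mathbf i$ precedes $\mathbf j$ lexicographically. Put $\kappa(\mathbf i)=\#\{\mathbf j\in\mathcal I^*:\mathbf j<_*\mathbf i\}$ (so $\kappa(\text{empty word})=0$, $\kappa(1)=1$, $\kappa(2)=2$, $\kappa(1,1)=3$, etc.). For an integer $m\ge2$ let $g_m(\mathbf i)=1$ if $\kappa(\mathbf i)\equiv 0\pmod m$ and $g_m(\mathbf i)=0$ otherwise. Writing $\mathbf i|_k=(i_1,\dots,i_k)$, define $$F_m=\Big\{x:\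 \{x\}=\bigcap_{n\ge1} f_{g_m(\mathbf i|_1)}\circ f_{g_m(\mathbf i|_2)}\circ\dots\circ f_{g_m(\mathbf i|_n)}([0,1])\ \text{ for some }\mathbf i\in\mathcal I\Big\}\subseteq C.$$ Symbolic space: for $L\in\mathbb N$, $X_L\subseteq\{0,1\}^{\mathbb N}$ is the set of sequences containing none of the words $10^k1$, $0\le k\le L-1$, as a block of consecutive letters (i.e. any two consecutive $1$'s are separated by at least $L$ zeros). $\rho_L\in(1,2)$ is the positive real root of $1+x^L=x^{L+1}$. The map $\pi:\{0,1\}^{\mathbb N}\to C$ is the natural projection $\pi(\mathbf j)=\lim_{n\to\infty}f_{j_1}\circ\dots\circ f_{j_n}(0)$. $\dim_H$ is Hausdorff dimension.
   Formalization: For r = 1/2 the stated preimage identity fails, since π is not injective (0^{L+1}1^∞ and 0^L10^∞ have the same image); there the preimage is the stated set together with the expansions w01^∞ of its members w10^∞. The identity for r < 1/2 and the dimension formula are unchanged. *)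

theory Defs
  imports "HOL-Analysis.Analysis"
begin

text \<open>
  Infinite sequences are functions on \<^typ>\<open>nat\<close>, indexed from \<open>0\<close>: the letter written \<open>j\<^sub>k\<close>
  with \<open>k \<ge> 1\<close> is \<open>j (k - 1)\<close>.
\<close>

subsection \<open>Hausdorff dimension\<close>

text \<open>
  \<open>diameter\<close> is junk on unbounded sets and \<open>0 powr 0 = 0\<close>; hence the boundedness requirement on
  covers below, and the separate clause making \<open>s = 0\<close> count nonempty sets.
\<close>

definition hausdorff_gauge :: "real \<Rightarrow> 'a::metric_space set \<Rightarrow> ennreal" where
  "hausdorff_gauge s U =
     (if U = {} then 0 else if s = 0 then 1 else ennreal (diameter U powr s))"

definition hausdorff_premeasure :: "real \<Rightarrow> real \<Rightarrow> 'a::metric_space set \<Rightarrow> ennreal" where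
  "hausdorff_premeasure \<delta> s A =
     (INF U \<in> {U :: nat \<Rightarrow> 'a set. A \<subseteq> (\<Union>n. U n) \<and> (\<forall>n. bounded (U n) \<and> diameter (U n) \<le> \<delta>)}.
        \<Sum>n. hausdorff_gauge s (U n))"

definition hausdorff_measure :: "real \<Rightarrow> 'a::metric_space set \<Rightarrow> ennreal" where
  "hausdorff_measure s A = (SUP \<delta> \<in> {0<..}. hausdorff_premeasure \<delta> s A)"

definition hausdorff_dim :: "'a::metric_space set \<Rightarrow> ereal" where
  "hausdorff_dim A = (INF s \<in> {s :: real. 0 \<le> s \<and> hausdorff_measure s A = 0}. ereal s)"

subsection \<open>The iterated function system\<close>

definition ifs_map :: "real \<Rightarrow> (nat \<Rightarrow> real) \<Rightarrow> nat \<Rightarrow> real \<Rightarrow> real" where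
  "ifs_map r b i x = r * x + b i"

definition unit_interval_ifs :: "real \<Rightarrow> (nat \<Rightarrow> real) \<Rightarrow> bool" where
  "unit_interval_ifs r b \<longleftrightarrow>
     (\<forall>i \<in> {0, 1}. ifs_map r b i ` {0..1} \<subseteq> {0..1}) \<and>
     ifs_map r b 0 ` {0<..<1} \<inter> ifs_map r b 1 ` {0<..<1} = {} \<and>
     (\<forall>x \<in> ifs_map r b 0 ` {0..1}. \<forall>y \<in> ifs_map r b 1 ` {0..1}. x \<le> y)"

definition ifs_word :: "real \<Rightarrow> (nat \<Rightarrow> real) \<Rightarrow> nat list \<Rightarrow> real \<Rightarrow> real" where
  "ifs_word r b w = foldr (\<lambda>i h. ifs_map r b i \<circ> h) w id"

definition binary_seqs :: "(nat \<Rightarrow> nat) set" where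
  "binary_seqs = UNIV \<rightarrow> {0, 1}"

definition code_proj :: "real \<Rightarrow> (nat \<Rightarrow> real) \<Rightarrow> (nat \<Rightarrow> nat) \<Rightarrow> real" where
  "code_proj r b j = lim (\<lambda>n. ifs_word r b (map j [0..<n]) 0)"

subsection \<open>The labelled tree and the sets \<open>F\<^sub>m\<close>\<close>

text \<open>\<open>lenlex less_than\<close> compares lengths first and words of equal length lexicographically.\<close>

definition tree_index :: "nat list \<Rightarrow> nat" where
  "tree_index w = card {v \<in> lists {1, 2}. (v, w) \<in> lenlex less_than}"

definition tree_label :: "nat \<Rightarrow> nat list \<Rightarrow> nat" where
  "tree_label m w = (if tree_index w mod m = 0 then 1 else 0)"

definition seq_prefix :: "(nat \<Rightarrow> 'a) \<Rightarrow> nat \<Rightarrow> 'a list" where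
  "seq_prefix t k = map t [0..<k]"

definition tree_fractal :: "real \<Rightarrow> (nat \<Rightarrow> real) \<Rightarrow> nat \<Rightarrow> real set" where
  "tree_fractal r b m =
     {x. \<exists>t \<in> UNIV \<rightarrow> {1, 2}.
        {x} = (\<Inter>n \<in> {1..}.
                 ifs_word r b (map (\<lambda>k. tree_label m (seq_prefix t k)) [1..<Suc n]) ` {0..1})}"

subsection \<open>The gap shift\<close>

definition gap_shift :: "nat \<Rightarrow> (nat \<Rightarrow> nat) set" where
  "gap_shift L =
     {j \<in> binary_seqs. \<forall>k < L. \<not> (\<exists>n. map j [n..<n + k + 2] = 1 # replicate k 0 @ [1])}"

definition gap_root :: "nat \<Rightarrow> real" where
  "gap_root L = (THE x. 0 < x \<and> 1 + x ^ L = x ^ (L + 1))"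

lemma gap_root_unique:
  fixes x y :: real
  assumes "0 < x" "1 + x ^ L = x ^ (L + 1)" "0 < y" "1 + y ^ L = y ^ (L + 1)"
  shows "x = y"
proof -
  have less: False if "0 < u" "u < v" "1 + u ^ L = u ^ (L + 1)" "1 + v ^ L = v ^ (L + 1)"
    for u v :: real
  proof -
    have u: "u ^ L * (u - 1) = 1" and v: "v ^ L * (v - 1) = 1"
      using that by (simp_all add: algebra_simps)
    have "u > 1"
      using u that(1) by (smt (verit) mult_nonneg_nonpos zero_le_power)
    have "u ^ L \<le> v ^ L"
      using that by (intro power_mono) auto
    moreover have "0 < u ^ L"
      using that by simp
    ultimately have "u ^ L * (u - 1) < v ^ L * (v - 1)"
      using that \<open>u > 1\<close> by (intro mult_le_less_imp_less) auto
    then show False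
      using u v by simp
  qed
  show ?thesis
    using less[of x y] less[of y x] assms by (cases x y rule: linorder_cases) auto
qed

lemma gap_root_props:
  assumes "L \<ge> 1"
  shows "1 < gap_root L" "gap_root L < 2" "1 + gap_root L ^ L = gap_root L ^ (L + 1)"
proof -
  let ?h = "\<lambda>x::real. x ^ (L + 1) - x ^ L"
  have two: "(2::real) ^ L > 1"
    using assms by (intro one_less_power) auto
  have "\<exists>x\<ge>1. x \<le> 2 \<and> ?h x = 1"
    using two by (intro IVT') (auto intro!: continuous_intros)
  then obtain x where x: "1 \<le> x" "x \<le> 2" "?h x = 1"
    by blast
  have "x \<noteq> 1" "x \<noteq> 2"
    using x two by auto
  moreover have "gap_root L = x"
    unfolding gap_root_def using x by (intro the_equality) (auto intro: gap_root_unique)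
  ultimately show "1 < gap_root L" "gap_root L < 2" "1 + gap_root L ^ L = gap_root L ^ (L + 1)"
    using x by auto
qed

subsection \<open>Sequences with two codings when the pieces touch\<close>

text \<open>
  For \<open>r = 1/2\<close> the points \<open>w10\<^sup>\<infinity>\<close> and \<open>w01\<^sup>\<infinity>\<close> have the same projection; these are the only
  coincidences. A preimage under the projection is therefore closed under passing to twins, so it
  cannot equal a set of sequences that contains \<open>w10\<^sup>\<infinity>\<close> but not \<open>w01\<^sup>\<infinity>\<close>.
\<close>

definition dyadic_twin :: "(nat \<Rightarrow> nat) \<Rightarrow> (nat \<Rightarrow> nat) \<Rightarrow> bool" where
  "dyadic_twin j' j \<longleftrightarrow>
     (\<exists>n. (\<forall>k < n. j k = j' k) \<and> j' n = 1 \<and> j n = 0 \<and> (\<forall>k > n. j' k = 0 \<and> j k = 1))"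

end

theory Submission
  imports Defs
begin

text \<open>
  Raised by one, the tree index of a word becomes a heap index: the root has \<open>x = 1\<close>, and the
  children of \<open>x\<close> are \<open>2 x\<close> and \<open>2 x + 1\<close>.  A vertex carries the label 1 iff \<open>x \<equiv> 1\<close> modulo \<open>m\<close>.

  From a vertex with residue 1, the vertices \<open>d\<close> levels further down have the residues of the numbers
  from \<open>2\<^sup>d\<close> to \<open>2\<^bsup>d+1\<^esup> - 1\<close>.  For \<open>1 \<le> d \<le> L\<close> all of these lie between 2 and \<open>m\<close>, so none is
  congruent to 1, and two labels 1 on a branch are more than \<open>L\<close> levels apart; as the root counts as
  a label 1 that is not read off, every label sequence starts with \<open>L\<close> zeros (\<open>label_seq_gapped\<close>).
  Conversely, \<open>m + 1\<close> occurs at depth \<open>L + 1\<close>, which realises the shortest return, and \<open>m\<close> occurs at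
  depth \<open>L\<close> or \<open>L + 1\<close>.  Residue 0 is a waiting room: \<open>2 x\<close> stays in it, and \<open>2 x + 1\<close> leaves it
  for residue 1.  So every longer return time, and no return at all, can be realised as well, and the
  label sequences are exactly the gapped ones (\<open>gapped_is_label_seq\<close>).

  Hence the fractal is the image of the gapped sequences under the coding map.  Comparing two codings
  at their first difference shows that the coding map is injective up to dyadic twins, which collide
  only for \<open>r = 1/2\<close>; the gapped sequence is then the twin ending in zeros, since \<open>L \<ge> 1\<close> forbids a tail
  of ones (\<open>code_proj_vimage\<close>).

  For the dimension, let \<open>q = 1 / \<rho>\<close> with \<open>\<rho>\<close> the gap root, so that \<open>q + q\<^bsup>L+1\<^esup> = 1\<close>.  Giving an
  admissible word of length \<open>n\<close> after which \<open>t\<close> zeros are still owed the weight \<open>q\<^bsup>n+t\<^esup>\<close> defines a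
  measure on the gapped sequences (\<open>gap_mass\<close>).  Its weights are comparable to \<open>q\<^sup>n\<close>, which is
  the \<open>d\<close>-th power of the length \<open>r\<^sup>n\<close> of the corresponding intervals, where \<open>d\<close> is the claimed
  dimension.  Counting intervals gives the upper bound (\<open>hausdorff_measure_gapped_zero\<close>).  The lower
  bound is the mass distribution principle (\<open>hausdorff_measure_gapped_nonzero\<close>): a ball of radius
  below \<open>r\<^sup>n\<close> meets at most three intervals of level \<open>n\<close>.
\<close>

section \<open>Gapped sequences\<close>

text \<open>
  The number \<open>t\<close> of zeros required at the start is a separate parameter because it decreases when
  leading zeros are removed, whereas \<open>L\<close> does not.
\<close>

definition gapped :: "nat \<Rightarrow> nat \<Rightarrow> (nat \<Rightarrow> nat) \<Rightarrow> bool" where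
  "gapped L t j \<longleftrightarrow> (\<forall>n. j n = 1 \<longrightarrow> t \<le> n \<and> (\<forall>k<n. j k = 1 \<longrightarrow> k + L < n))"

lemma binary_seqs_iff: "j \<in> binary_seqs \<longleftrightarrow> (\<forall>k. j k = 0 \<or> j k = 1)"
  by (auto simp: binary_seqs_def Pi_iff)

lemma gapped_imp_gap_shift:
  assumes "j \<in> binary_seqs" "gapped L t j"
  shows "j \<in> gap_shift L"
proof -
  have no: False if "k < L" "map j [n..<n + k + 2] = 1 # replicate k 0 @ [1]" for k n
  proof -
    let ?w = "1 # replicate k (0::nat) @ [1]"
    have "j (n + i) = ?w ! i" if "i < k + 2" for i
      using arg_cong[OF \<open>map j [n..<n + k + 2] = ?w\<close>, of "\<lambda>xs. xs ! i"] that
      by (simp del: upt_Suc add: nth_map_upt)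
    from this[of 0] this[of "Suc k"] have "j n = 1" "j (n + Suc k) = 1"
      by (auto simp: nth_append)
    moreover have "\<forall>k'<n + Suc k. j k' = 1 \<longrightarrow> k' + L < n + Suc k"
      using calculation assms(2) by (simp add: gapped_def)
    ultimately have "n + L < n + Suc k" by simp
    with \<open>k < L\<close> show False by simp
  qed
  show ?thesis
    unfolding gap_shift_def
    by (intro CollectI conjI allI impI notI assms(1)) (elim exE, rule no)
qed

lemma gap_shift_separation:
  assumes j: "j \<in> gap_shift L" and "k < n" "j k = 1" "j n = 1"
  shows "k + L < n"
proof (rule ccontr)
  assume "\<not> k + L < n"
  \<comment> \<open>The gap shift constrains consecutive ones only, so the next 1 after \<open>k\<close> replaces \<open>n\<close>.\<close>
  define p where "p = (LEAST i. k < i \<and> j i = 1)"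
  have p: "k < p" "j p = 1"
    using LeastI[of "\<lambda>i. k < i \<and> j i = 1" n] assms by (auto simp: p_def)
  have "p \<le> n"
    unfolding p_def using assms by (intro Least_le) auto
  have "j i \<in> {0, 1}" for i
    using j by (auto simp: gap_shift_def binary_seqs_def)
  moreover have "j i \<noteq> 1" if "k < i" "i < p" for i
    using that not_less_Least[of i "\<lambda>i. k < i \<and> j i = 1"] by (auto simp: p_def)
  ultimately have zero: "j i = 0" if "k < i" "i < p" for i
    using that by blast
  have "map j [k..<p + 1] = 1 # replicate (p - k - 1) 0 @ [1]"
  proof (rule nth_equalityI)
    fix i assume "i < length (map j [k..<p + 1])"
    then have i: "i < p + 1 - k" by (simp del: upt_Suc)
    then have "map j [k..<p + 1] ! i = j (k + i)"
      by (simp del: upt_Suc add: nth_map_upt)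
    also have "\<dots> = (1 # replicate (p - k - 1) 0 @ [1]) ! i"
    proof -
      consider "i = 0" | "i = Suc (p - k - 1)" | i' where "i = Suc i'" "i' < p - k - 1"
        using i p by (cases i) (auto, force)
      then show ?thesis
      proof cases
        case 1
        with assms show ?thesis by simp
      next
        case 2
        with p show ?thesis by (simp add: nth_append)
      next
        case 3
        with zero[of "k + i"] show ?thesis by (simp add: nth_append)
      qed
    qed
    finally show "map j [k..<p + 1] ! i = (1 # replicate (p - k - 1) 0 @ [1]) ! i" .
  qed (use p in \<open>simp del: upt_Suc\<close>)
  moreover have "p + 1 = k + (p - k - 1) + 2"
    using p by simp
  ultimately have "\<exists>n. map j [n..<n + (p - k - 1) + 2] = 1 # replicate (p - k - 1) 0 @ [1]"
    by metis
  moreover have "p - k - 1 < L"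
    using \<open>\<not> k + L < n\<close> \<open>p \<le> n\<close> p by simp
  moreover have "\<forall>k<L. \<not> (\<exists>n. map j [n..<n + k + 2] = 1 # replicate k 0 @ [1])"
    using j unfolding gap_shift_def mem_Collect_eq by (rule conjunct2)
  ultimately show False
    by meson
qed

lemma initially_zero_gap_shift:
  "{j \<in> gap_shift L. \<forall>k < L. j k = 0} = {j \<in> binary_seqs. gapped L L j}"
proof (intro equalityI subsetI)
  fix j assume j: "j \<in> {j \<in> gap_shift L. \<forall>k < L. j k = 0}"
  then have "L \<le> n" if "j n = 1" for n
    using that by (metis (mono_tags, lifting) mem_Collect_eq not_le zero_neq_one)
  with j gap_shift_separation[of j L] show "j \<in> {j \<in> binary_seqs. gapped L L j}"
    by (auto simp: gapped_def gap_shift_def)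
next
  fix j assume j: "j \<in> {j \<in> binary_seqs. gapped L L j}"
  then have "j k = 0" if "k < L" for k
    using that by (force simp: gapped_def binary_seqs_def dest: funcset_mem[of j _ _ k])
  with j gapped_imp_gap_shift show "j \<in> {j \<in> gap_shift L. \<forall>k < L. j k = 0}"
    by auto
qed

section \<open>The tree index along a branch\<close>

lemma finite_lenlex_below: "finite {v \<in> lists {1, 2::nat}. (v, w) \<in> lenlex less_than}"
proof (rule finite_subset)
  show "{v \<in> lists {1, 2::nat}. (v, w) \<in> lenlex less_than}
      \<subseteq> {v. set v \<subseteq> {1, 2} \<and> length v \<le> length w}"
    using lenlex_length by fastforce
  show "finite {v. set v \<subseteq> {1, 2::nat} \<and> length v \<le> length w}"
    by (rule finite_lists_length_le) simp
qed

lemma lenlex_snoc_iff: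
  "(v @ [c], w @ [i]) \<in> lenlex less_than \<longleftrightarrow> (v, w) \<in> lenlex less_than \<or> v = w \<and> c < (i::nat)"
proof -
  have irr: "irrefl less_than" by (auto simp: irrefl_def)
  have tot: "total less_than" by (auto simp: total_on_def)
  consider "v = w" | "(v, w) \<in> lenlex less_than" | "(w, v) \<in> lenlex less_than"
    using total_lenlex[OF tot] by (auto simp: total_on_def)
  then show ?thesis
  proof cases
    case 1
    then show ?thesis
      using irr lenlex_irreflexive[of less_than w] by (auto simp: Cons_lenlex_iff)
  next
    case 2
    with lenlex_append1[of v w less_than "[c]" "[i]"] show ?thesis by simp
  next
    case 3
    then have "(w @ [i], v @ [c]) \<in> lenlex less_than"
      using lenlex_append1[of w v less_than "[i]" "[c]"] by simp
    moreover have asym: "asym (lenlex less_than)"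
      by (intro asym_lenlex) (simp add: asym_on_def)
    ultimately have "(v @ [c], w @ [i]) \<notin> lenlex less_than"
      by (meson asym asymD)
    moreover have "(v, w) \<notin> lenlex less_than" "v \<noteq> w"
      using 3 asym by (meson asymD, metis asymD)
    ultimately show ?thesis by blast
  qed
qed

lemma tree_index_Nil: "tree_index [] = 0"
  by (simp add: tree_index_def)

text \<open>
  The predecessors of \<open>w @ [i]\<close> are the empty word, both children of every predecessor of \<open>w\<close>, and the
  \<open>i - 1\<close> earlier siblings.
\<close>

lemma tree_index_snoc:
  assumes "w \<in> lists {1, 2}" "i \<in> {1, 2}"
  shows "tree_index (w @ [i]) = 2 * tree_index w + i"
proof -
  let ?B = "{v \<in> lists {1, 2}. (v, w) \<in> lenlex less_than}"
  let ?s = "\<lambda>(v, c). v @ [c :: nat]"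
  have eq: "{v \<in> lists {1, 2}. (v, w @ [i]) \<in> lenlex less_than}
      = insert [] (?s ` (?B \<times> {1, 2} \<union> {w} \<times> {1..<i}))" (is "?L = ?R")
  proof (intro equalityI subsetI)
    fix v assume v: "v \<in> ?L"
    show "v \<in> ?R"
    proof (cases v rule: rev_cases)
      case (snoc u c)
      with v have "(u, c) \<in> ?B \<times> {1, 2} \<union> {w} \<times> {1..<i}"
        by (auto simp: lenlex_snoc_iff)
      with snoc show ?thesis by force
    qed simp
  next
    fix v assume "v \<in> ?R"
    with assms show "v \<in> ?L"
      by (auto simp: lenlex_snoc_iff)
  qed
  have inj: "inj_on ?s A" for A
    by (auto simp: inj_on_def)
  have cB: "card (?B \<times> {1, 2} \<union> {w} \<times> {1..<i}) = 2 * card ?B + (i - 1)"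
  proof -
    have "card (?B \<times> {1, 2} \<union> {w} \<times> {1..<i}) = card (?B \<times> {1::nat, 2}) + card ({w} \<times> {1..<i})"
      using finite_lenlex_below[of w] lenlex_irreflexive[of less_than w]
      by (intro card_Un_disjoint) auto
    also have "card (?B \<times> {1::nat, 2}) = 2 * card ?B"
      by (simp add: card_cartesian_product del: One_nat_def)
    finally show ?thesis by (simp add: card_cartesian_product del: One_nat_def)
  qed
  have "card ?L = Suc (2 * card ?B + (i - 1))"
    using finite_lenlex_below[of w]
    by (subst eq, subst card_insert_disjoint) (auto simp: card_image[OF inj] cB simp del: One_nat_def)
  with assms show ?thesis by (auto simp: tree_index_def)
qed

section \<open>Label sequences are exactly the gapped sequences\<close>

definition label_seq :: "nat \<Rightarrow> (nat \<Rightarrow> nat) \<Rightarrow> nat \<Rightarrow> nat" where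
  "label_seq m t k = tree_label m (seq_prefix t (Suc k))"

lemma seq_prefix_in_lists: "t \<in> UNIV \<rightarrow> A \<Longrightarrow> seq_prefix t n \<in> lists A"
  by (auto simp: seq_prefix_def Pi_iff)

lemma tree_index_prefix_Suc:
  assumes "t \<in> UNIV \<rightarrow> {1, 2}"
  shows "tree_index (seq_prefix t (Suc n)) = 2 * tree_index (seq_prefix t n) + t n"
  using tree_index_snoc[OF seq_prefix_in_lists[OF assms], of "t n" n] assms
  by (auto simp: seq_prefix_def)

lemma tree_index_prefix_add:
  assumes t: "t \<in> UNIV \<rightarrow> {1, 2}"
  shows "\<exists>v. tree_index (seq_prefix t (n + d)) = 2 ^ d * tree_index (seq_prefix t n) + v
    \<and> 2 ^ d \<le> v + 1 \<and> v + 2 \<le> 2 ^ (d + 1)"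
proof (induction d)
  case (Suc d)
  then obtain v where v: "tree_index (seq_prefix t (n + d)) = 2 ^ d * tree_index (seq_prefix t n) + v"
    "2 ^ d \<le> v + 1" "v + 2 \<le> 2 ^ (d + 1)" by auto
  moreover have "t (n + d) = 1 \<or> t (n + d) = 2" using t by auto
  ultimately show ?case
    by (intro exI[of _ "2 * v + t (n + d)"]) (auto simp: tree_index_prefix_Suc[OF t])
qed simp

text \<open>
  Each index \<open>d\<close> levels below one divisible by \<open>m\<close>, where \<open>0 < d \<le> L\<close>, is congruent to some \<open>v\<close> with
  \<open>0 < v < m\<close>.
\<close>

lemma label_distance:
  assumes t: "t \<in> UNIV \<rightarrow> {1, 2}" and "2 ^ (L + 1) \<le> m + 1"
    and "tree_index (seq_prefix t n) mod m = 0" "tree_index (seq_prefix t (n + d)) mod m = 0"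
    and "0 < d"
  shows "L < d"
proof (rule ccontr)
  assume "\<not> L < d"
  obtain v where v: "tree_index (seq_prefix t (n + d)) = 2 ^ d * tree_index (seq_prefix t n) + v"
    "2 ^ d \<le> v + 1" "v + 2 \<le> 2 ^ (d + 1)"
    using tree_index_prefix_add[OF t] by blast
  have "(2::nat) ^ 1 \<le> 2 ^ d" "(2::nat) ^ (d + 1) \<le> 2 ^ (L + 1)"
    using \<open>0 < d\<close> \<open>\<not> L < d\<close> by (intro power_increasing; simp)+
  with v assms(2) have "0 < v" "v < m" unfolding power_one_right by linarith+
  moreover have "m dvd v"
    using assms(3,4) v(1) by (metis dvd_add_right_iff dvd_mult mod_0_imp_dvd)
  ultimately show False using nat_dvd_not_less by blast
qed

lemma label_seq_gapped:
  assumes t: "t \<in> UNIV \<rightarrow> {1, 2}" and m: "2 ^ (L + 1) \<le> m + 1"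
  shows "label_seq m t \<in> binary_seqs" "gapped L L (label_seq m t)"
proof -
  have one: "tree_index (seq_prefix t (Suc n)) mod m = 0" if "label_seq m t n = 1" for n
    using that by (auto simp: label_seq_def tree_label_def split: if_splits)
  show "label_seq m t \<in> binary_seqs"
    by (auto simp: binary_seqs_def label_seq_def tree_label_def)
  \<comment> \<open>The root has index 0, so it acts as a first label 1 in front of the sequence.\<close>
  have "L \<le> n" if "label_seq m t n = 1" for n
    using label_distance[OF t m, of 0 "Suc n"] one[OF that]
    by (simp add: seq_prefix_def tree_index_Nil)
  moreover have "k + L < n" if "label_seq m t n = 1" "label_seq m t k = 1" "k < n" for n k
    using label_distance[OF t m, of "Suc k" "n - k"] one[OF that(1)] one[OF that(2)] \<open>k < n\<close>
    by simp
  ultimately show "gapped L L (label_seq m t)"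
    by (auto simp: gapped_def)
qed

text \<open>
  Cutting low-order bits off a number retraces its ancestors in the heap; this and the next lemma
  describe the path from the root to a prescribed vertex.
\<close>

lemma binary_prefix_double:
  fixes y D e :: nat
  assumes "e < D"
  shows "\<exists>c\<in>{0, 1}. y div 2 ^ (D - Suc e) = 2 * (y div 2 ^ (D - e)) + c"
proof -
  have "y div 2 ^ (D - e) = y div 2 ^ (D - Suc e) div 2"
    using assms by (metis Suc_diff_Suc div_mult2_eq power_Suc2)
  then have "y div 2 ^ (D - Suc e) = 2 * (y div 2 ^ (D - e)) + y div 2 ^ (D - Suc e) mod 2"
    by simp
  moreover have "y div 2 ^ (D - Suc e) mod 2 \<in> {0, 1}" by auto
  ultimately show ?thesis by (intro bexI[of _ "y div 2 ^ (D - Suc e) mod 2"])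
qed

lemma binary_prefix_bounds:
  fixes y D e :: nat
  assumes "2 ^ D \<le> y" "y < 2 ^ (D + 1)" "e \<le> D"
  shows "2 ^ e \<le> y div 2 ^ (D - e)" "y div 2 ^ (D - e) < 2 ^ (e + 1)"
proof -
  have "(2::nat) ^ e * 2 ^ (D - e) = 2 ^ D" "(2::nat) ^ (e + 1) * 2 ^ (D - e) = 2 ^ (D + 1)"
    using \<open>e \<le> D\<close> by (simp_all flip: power_add)
  with assms show "2 ^ e \<le> y div 2 ^ (D - e)" "y div 2 ^ (D - e) < 2 ^ (e + 1)"
    by (auto simp: less_eq_div_iff_mult_less_eq div_less_iff_less_mult)
qed

lemma cong_one_range:
  fixes y m :: nat
  assumes "2 \<le> y" "y \<le> m" "m \<ge> 3"
  shows "y mod m \<noteq> 1"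
  using assms by (cases "y = m") auto

text \<open>
  The quickest return to residue 1: the path to the vertex \<open>m + 1\<close>, which has depth \<open>L + 1\<close>.
\<close>

lemma heap_path_tight:
  fixes m L :: nat
  assumes "m \<ge> 3" "2 ^ (L + 1) \<le> m + 1" "m + 1 < 2 ^ (L + 2)"
  shows "\<exists>a. a 0 = 1 \<and> (\<forall>e\<le>L. \<exists>c\<in>{0, 1::nat}. a (Suc e) = 2 * a e + c) \<and> a (L + 1) = m + 1 \<and>
    (\<forall>e. 0 < e \<and> e \<le> L \<longrightarrow> a e mod m \<noteq> 1)"
proof -
  define a where "a e = (m + 1) div 2 ^ (L + 1 - e)" for e
  have b: "2 ^ e \<le> a e" "a e < 2 ^ (e + 1)" if "e \<le> L + 1" for e
    unfolding a_def using binary_prefix_bounds[of "L + 1" "m + 1" e] assms that by auto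
  have "a e mod m \<noteq> 1" if "0 < e" "e \<le> L" for e
  proof (rule cong_one_range)
    have "(2::nat) ^ 1 \<le> 2 ^ e" "(2::nat) ^ (e + 1) \<le> 2 ^ (L + 1)"
      using that by (intro power_increasing; simp)+
    moreover have "2 ^ e \<le> a e" "a e < 2 ^ (e + 1)" using b[of e] that by auto
    ultimately show "2 \<le> a e" "a e \<le> m" using assms unfolding power_one_right by linarith+
  qed fact
  moreover have "\<exists>c\<in>{0, 1::nat}. a (Suc e) = 2 * a e + c" if "e \<le> L" for e
    unfolding a_def using that by (intro binary_prefix_double) simp
  moreover have "a 0 = 1" using b[of 0] by simp
  moreover have "a (L + 1) = m + 1" by (simp add: a_def)
  ultimately show ?thesis by blast
qed

text \<open>
  A path that never returns to residue 1 and rests in residue 0 from depth \<open>L + 1\<close> on, so that it can be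
  redirected to residue 1 by a single odd step at any later time.  It runs to the vertex \<open>m\<close>, whose
  depth is \<open>L + 1\<close>, or \<open>L\<close> if \<open>m = 2\<^bsup>L+1\<^esup> - 1\<close>.
\<close>

lemma heap_path_loose:
  fixes m L :: nat
  assumes "m \<ge> 3" "2 ^ (L + 1) \<le> m + 1" "m + 1 < 2 ^ (L + 2)"
  shows "\<exists>z. z 0 = 1 \<and> (\<forall>e. \<exists>c\<in>{0, 1::nat}. z (Suc e) mod m = (2 * z e + c) mod m) \<and>
    (\<forall>e>L. z e mod m = 0) \<and> (\<forall>e>0. z e mod m \<noteq> 1)"
proof -
  define D where "D = (if m < 2 ^ (L + 1) then L else L + 1)"
  define z where "z e = (if e \<le> D then m div 2 ^ (D - e) else 0)" for e
  have m: "2 ^ D \<le> m" "m < 2 ^ (D + 1)"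
    using assms by (auto simp: D_def)
  have b: "2 ^ e \<le> z e" "z e < 2 ^ (e + 1)" if "e \<le> D" for e
    unfolding z_def using binary_prefix_bounds[of D m e] m that by auto
  have zero: "z e mod m = 0" if "D \<le> e" for e
    using that by (auto simp: z_def)
  have "z e mod m \<noteq> 1" if "0 < e" for e
  proof (cases "e \<le> D")
    case True
    have "(2::nat) ^ 1 \<le> 2 ^ e"
      using that by (intro power_increasing) auto
    with b[of e] True have "2 \<le> z e" by simp
    moreover have "z e \<le> m" by (simp add: z_def)
    ultimately show ?thesis using cong_one_range assms(1) by blast
  next
    case False
    then show ?thesis by (simp add: z_def)
  qed
  moreover have "\<exists>c\<in>{0, 1::nat}. z (Suc e) mod m = (2 * z e + c) mod m" for e
  proof (cases "e < D")
    case True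
    then show ?thesis using binary_prefix_double[of e D m] by (auto simp: z_def)
  next
    case False
    then have "z (Suc e) mod m = 0" "z e mod m = 0" using zero by auto
    then have "z (Suc e) mod m = (2 * z e + 0) mod m" by auto
    then show ?thesis by blast
  qed
  moreover have "z 0 = 1" using b[of 0] by simp
  moreover have "\<forall>e>L. z e mod m = 0" using zero by (auto simp: D_def)
  ultimately show ?thesis by blast
qed

text \<open>
  At each time in \<open>J\<close> the branch decides which of the two paths above to follow: the quick one if the
  next time in \<open>J\<close> comes after \<open>L + 1\<close> steps, the waiting one otherwise.  The choice depends on the
  future of \<open>J\<close> but not on the branch, so the branch can be built step by step.
\<close>

lemma heap_residues_exist:
  fixes m L :: nat and J :: "nat \<Rightarrow> bool"
  assumes m: "m \<ge> 3" "2 ^ (L + 1) \<le> m + 1" "m + 1 < 2 ^ (L + 2)"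
    and J0: "J 0" and sep: "\<And>k n. J k \<Longrightarrow> J n \<Longrightarrow> k < n \<Longrightarrow> k + L < n"
  shows "\<exists>x. x 0 = 1 \<and> (\<forall>n. x (Suc n) \<in> {2 * x n, 2 * x n + 1}) \<and>
    (\<forall>n. x n mod m = 1 \<longleftrightarrow> J n)"
proof -
  obtain a where a: "a 0 = 1" "\<And>e. e \<le> L \<Longrightarrow> \<exists>c\<in>{0, 1::nat}. a (Suc e) = 2 * a e + c"
    "a (L + 1) = m + 1" "\<And>e. 0 < e \<Longrightarrow> e \<le> L \<Longrightarrow> a e mod m \<noteq> 1"
    using heap_path_tight[OF m] by blast
  obtain z where z: "z 0 = 1" "\<And>e. \<exists>c\<in>{0, 1::nat}. z (Suc e) mod m = (2 * z e + c) mod m"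
    "\<And>e. L < e \<Longrightarrow> z e mod m = 0" "\<And>e. 0 < e \<Longrightarrow> z e mod m \<noteq> 1"
    using heap_path_loose[OF m] by blast
  \<comment> \<open>Residue to be reached \<open>e\<close> steps after the latest time \<open>l\<close> in \<open>J\<close>.\<close>
  define guide where "guide l e = (if J (l + L + 1) then a e else z e)" for l e
  define Inv where "Inv n x \<longleftrightarrow> (\<exists>l e. n = l + e \<and> J l \<and> (\<forall>i. l < i \<and> i \<le> n \<longrightarrow> \<not> J i) \<and>
    x mod m = guide l e mod m)" for n x
  have start: "guide l 0 mod m = 1" for l
    using a z m by (simp add: guide_def)
  have J_iff: "x mod m = 1 \<longleftrightarrow> J n" if inv: "Inv n x" for n x
  proof -
    obtain l e where le: "n = l + e" "J l" "\<forall>i. l < i \<and> i \<le> n \<longrightarrow> \<not> J i"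
      "x mod m = guide l e mod m"
      using inv unfolding Inv_def by blast
    show ?thesis
    proof (cases "e = 0")
      case True
      then show ?thesis using le start by simp
    next
      case False
      have "e \<le> L" if "J (l + L + 1)"
        using le(1) le(3)[rule_format, of "l + L + 1"] that
        by (intro leI notI) (simp add: Suc_le_eq)
      with False have "guide l e mod m \<noteq> 1"
        using a(4) z(4) by (auto simp: guide_def)
      with le False show ?thesis by auto
    qed
  qed
  have cong: "(2 * x + c) mod m = (2 * y + c) mod m" if "x mod m = y mod m" for x y c
    using mod_add_cong[OF mod_mult_cong[OF refl that] refl] .
  have step: "\<exists>y. Inv (Suc n) y \<and> y \<in> {2 * x, 2 * x + 1}" if inv: "Inv n x" for n x
  proof -
    obtain l e where le: "n = l + e" "J l" "\<forall>i. l < i \<and> i \<le> n \<longrightarrow> \<not> J i"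
      "x mod m = guide l e mod m"
      using inv unfolding Inv_def by blast
    have eL: "e \<le> L" if "J (l + L + 1)"
      using le(1) le(3)[rule_format, of "l + L + 1"] that
      by (intro leI notI) (simp add: Suc_le_eq)
    show ?thesis
    proof (cases "J (Suc n)")
      case True
      have "l + L < Suc n" using sep[OF le(2) True] le(1) by simp
      have "\<exists>c\<in>{0, 1}. (2 * guide l e + c) mod m = 1"
      proof (cases "J (l + L + 1)")
        case True
        then have "e = L" using eL \<open>l + L < Suc n\<close> le(1) by simp
        then obtain c where "c \<in> {0, 1}" "m + 1 = 2 * a e + c" using a(2)[of L] a(3) by auto
        moreover have "(m + 1) mod m = 1" using m(1) by (simp only: mod_add_self1) simp
        ultimately show ?thesis using True by (auto simp: guide_def)
      next
        case False
        with True have "e \<noteq> L" using le(1) by auto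
        then have "z e mod m = 0" using z(3) \<open>l + L < Suc n\<close> le(1) by simp
        then have "(2 * z e + 1) mod m = 1"
          using cong[of "z e" 0 1] m(1) by simp
        then show ?thesis using False by (auto simp: guide_def)
      qed
      then obtain c where "c \<in> {0, 1}" "(2 * x + c) mod m = 1"
        using cong[OF le(4)] by metis
      then have "Inv (Suc n) (2 * x + c)"
        unfolding Inv_def using True start by (intro exI[of _ "Suc n"] exI[of _ 0]) auto
      then show ?thesis using \<open>c \<in> {0, 1}\<close> by auto
    next
      case False
      have "\<exists>c\<in>{0, 1}. guide l (Suc e) mod m = (2 * guide l e + c) mod m"
      proof (cases "J (l + L + 1)")
        case True
        with eL a(2)[of e] show ?thesis by (auto simp: guide_def)
      next
        case False
        with z(2)[of e] show ?thesis by (auto simp: guide_def)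
      qed
      then obtain c where c: "c \<in> {0, 1}" "(2 * x + c) mod m = guide l (Suc e) mod m"
        using cong[OF le(4)] by metis
      have "Inv (Suc n) (2 * x + c)"
        unfolding Inv_def using False le c
        by (intro exI[of _ l] exI[of _ "Suc e"]) (auto simp: le_Suc_eq)
      then show ?thesis using c by auto
    qed
  qed
  have "Inv 0 1" unfolding Inv_def using J0 start m by auto
  then have "\<exists>x. \<forall>n. (Inv n (x n) \<and> (n = 0 \<longrightarrow> x n = 1)) \<and> x (Suc n) \<in> {2 * x n, 2 * x n + 1}"
    using step by (intro dependent_nat_choice) auto
  then obtain x where "\<And>n. Inv n (x n)" "x 0 = 1" "\<And>n. x (Suc n) \<in> {2 * x n, 2 * x n + 1}"
    by blast
  then show ?thesis using J_iff by (intro exI[of _ x]) auto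
qed

text \<open>
  The set \<open>J\<close> contains 0 for the root, so the positions of the ones in \<open>j\<close> are shifted by one; the \<open>L\<close>
  initial zeros become the separation from time 0.
\<close>

lemma gapped_is_label_seq:
  assumes m: "m \<ge> 3" "2 ^ (L + 1) \<le> m + 1" "m + 1 < 2 ^ (L + 2)"
    and j: "j \<in> binary_seqs" "gapped L L j"
  shows "\<exists>t \<in> UNIV \<rightarrow> {1, 2}. label_seq m t = j"
proof -
  define J where "J n \<longleftrightarrow> (case n of 0 \<Rightarrow> True | Suc k \<Rightarrow> j k = 1)" for n
  have "k + L < n" if "J k" "J n" "k < n" for k n
    using that j(2) by (auto simp: J_def gapped_def split: nat.splits)
  then obtain x where x: "x 0 = 1" "\<And>n. x (Suc n) \<in> {2 * x n, 2 * x n + 1}"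
    "\<And>n. x n mod m = 1 \<longleftrightarrow> J n"
    using heap_residues_exist[OF m, of J] by (auto simp: J_def)
  define t where "t n = x (Suc n) - 2 * x n + 1" for n
  have t: "t \<in> UNIV \<rightarrow> {1, 2}"
  proof
    fix n show "t n \<in> {1, 2}" using x(2)[of n] by (auto simp: t_def)
  qed
  have idx: "Suc (tree_index (seq_prefix t n)) = x n" for n
  proof (induction n)
    case 0
    then show ?case by (simp add: seq_prefix_def tree_index_Nil x)
  next
    case (Suc n)
    have "Suc (2 * tree_index (seq_prefix t n) + t n) = x (Suc n)"
      using x(2)[of n] Suc by (auto simp: t_def[of n])
    then show ?case
      by (simp only: tree_index_prefix_Suc[OF t])
  qed
  have "label_seq m t k = j k" for k
  proof -
    let ?i = "tree_index (seq_prefix t (Suc k))"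
    have "?i mod m = 0 \<longleftrightarrow> Suc ?i mod m = 1"
      using m(1) by (auto simp: mod_Suc)
    also have "\<dots> \<longleftrightarrow> j k = 1"
      using x(3)[of "Suc k"] idx[of "Suc k"] by (simp add: J_def)
    finally show ?thesis
      using funcset_mem[of j UNIV _ k] j(1)
      by (auto simp: label_seq_def tree_label_def binary_seqs_def)
  qed
  with t show ?thesis by blast
qed

section \<open>The coding map\<close>

lemma ifs_word_Nil [simp]: "ifs_word r b [] x = x"
  by (simp add: ifs_word_def)

lemma ifs_word_Cons [simp]: "ifs_word r b (a # w) x = r * ifs_word r b w x + b a"
  by (simp add: ifs_word_def ifs_map_def)

lemma ifs_word_append: "ifs_word r b (v @ w) x = ifs_word r b v (ifs_word r b w x)"
  by (induction v) auto

lemma ifs_word_eq_sum: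
  "ifs_word r b w x = r ^ length w * x + (\<Sum>k<length w. b (w ! k) * r ^ k)"
  by (induction w)
    (simp_all del: sum.lessThan_Suc add: sum.lessThan_Suc_shift sum_distrib_left algebra_simps)

lemma ifs_word_diff: "ifs_word r b w x - ifs_word r b w y = r ^ length w * (x - y)"
  by (simp add: ifs_word_eq_sum right_diff_distrib)

locale two_map_ifs =
  fixes r :: real and b :: "nat \<Rightarrow> real"
  assumes r_pos: "0 < r" and r_half: "r \<le> 1 / 2" and ifs: "unit_interval_ifs r b"
begin

lemma translation_bounds:
  shows "i \<in> {0, 1} \<Longrightarrow> 0 \<le> b i" and "i \<in> {0, 1} \<Longrightarrow> r + b i \<le> 1" and "r \<le> b 1 - b 0"
proof -
  have sub: "ifs_map r b i ` {0..1} \<subseteq> {0..1}" if "i \<in> {0, 1}" for i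
    using ifs that by (auto simp: unit_interval_ifs_def)
  have "ifs_map r b i 0 \<in> {0..1}" "ifs_map r b i 1 \<in> {0..1}" if "i \<in> {0, 1}" for i
    using sub[OF that] by (auto simp: image_subset_iff)
  then show "0 \<le> b i" "r + b i \<le> 1" if "i \<in> {0, 1}"
    using that by (auto simp: ifs_map_def)
  have "\<forall>x\<in>ifs_map r b 0 ` {0..1}. \<forall>y\<in>ifs_map r b 1 ` {0..1}. x \<le> y"
    using ifs by (simp add: unit_interval_ifs_def)
  then have "ifs_map r b 0 1 \<le> ifs_map r b 1 0" by auto
  then show "r \<le> b 1 - b 0" by (simp add: ifs_map_def)
qed

lemma b_binary: "j \<in> binary_seqs \<Longrightarrow> b (j k) = b 0 + (b 1 - b 0) * j k"
  by (auto simp: binary_seqs_iff dest!: spec[of _ k])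

lemma b_binary_bounds:
  assumes "j \<in> binary_seqs"
  shows "0 \<le> b (j k)" "b (j k) \<le> 1"
proof -
  have "j k \<in> {0, 1}" using assms by (simp add: binary_seqs_iff)
  from translation_bounds(1,2)[OF this] r_pos show "0 \<le> b (j k)" "b (j k) \<le> 1" by auto
qed

lemma summable_proj:
  assumes "j \<in> binary_seqs"
  shows "summable (\<lambda>k. b (j k) * r ^ k)"
proof (rule summable_comparison_test')
  show "summable (\<lambda>k. r ^ k)"
    using r_pos r_half by (intro summable_geometric) auto
  show "norm (b (j k) * r ^ k) \<le> r ^ k" if "0 \<le> k" for k
    using b_binary_bounds[OF assms, of k] r_pos by (simp add: abs_mult mult_le_cancel_right1)
qed

lemma code_proj_sum:
  assumes "j \<in> binary_seqs"
  shows "code_proj r b j = (\<Sum>k. b (j k) * r ^ k)"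
  unfolding code_proj_def
  using summable_LIMSEQ[OF summable_proj[OF assms]]
  by (intro limI) (simp add: ifs_word_eq_sum)

lemma binary_shift: "j \<in> binary_seqs \<Longrightarrow> (\<lambda>k. j (k + n)) \<in> binary_seqs"
  by (auto simp: binary_seqs_iff)

lemma code_proj_split:
  assumes "j \<in> binary_seqs"
  shows "code_proj r b j = ifs_word r b (map j [0..<n]) (code_proj r b (\<lambda>k. j (k + n)))"
proof -
  have "(\<Sum>k. b (j (k + n)) * r ^ (k + n)) = r ^ n * (\<Sum>k. b (j (k + n)) * r ^ k)"
    using suminf_mult[OF summable_proj[OF binary_shift[OF assms, of n]], of "r ^ n"]
    by (simp add: power_add mult_ac)
  then show ?thesis
    using suminf_split_initial_segment[OF summable_proj[OF assms], of n]
    by (simp add: code_proj_sum assms binary_shift ifs_word_eq_sum)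
qed

lemma ifs_word_in_unit:
  assumes "set w \<subseteq> {0, 1}" "x \<in> {0..1}"
  shows "ifs_word r b w x \<in> {0..1}"
  using assms(1)
proof (induction w)
  case (Cons a w)
  then have IH: "0 \<le> ifs_word r b w x" "ifs_word r b w x \<le> 1" and a: "a \<in> {0, 1}" by auto
  have "0 \<le> r * ifs_word r b w x" "r * ifs_word r b w x \<le> r * 1"
    using IH r_pos by (intro mult_nonneg_nonneg mult_left_mono; simp)+
  with translation_bounds(1,2)[OF a] show ?case by auto
qed (use assms in auto)

lemma code_proj_in_unit:
  assumes "j \<in> binary_seqs"
  shows "code_proj r b j \<in> {0..1}"
proof -
  have "(\<lambda>n. ifs_word r b (map j [0..<n]) 0) \<longlonglongrightarrow> code_proj r b j"
    using summable_LIMSEQ[OF summable_proj[OF assms]]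
    by (simp add: ifs_word_eq_sum code_proj_sum assms)
  moreover have "ifs_word r b (map j [0..<n]) 0 \<in> {0..1}" for n
    using assms by (intro ifs_word_in_unit) (force simp: binary_seqs_def Pi_iff)+
  ultimately show ?thesis
    by (meson closed_atLeastAtMost closed_sequentially)
qed

lemma code_proj_in_cylinder:
  assumes "j \<in> binary_seqs"
  shows "code_proj r b j \<in> ifs_word r b (map j [0..<n]) ` {0..1}"
  using code_proj_split[OF assms, of n] code_proj_in_unit[OF binary_shift[OF assms, of n]] by blast

text \<open>
  Together with \<open>code_proj_in_cylinder\<close> this pins down the intersection of nested cylinders, and it
  bounds the diameters in the dimension estimate.
\<close>

lemma cylinder_dist:
  assumes "x \<in> ifs_word r b w ` {0..1}" "y \<in> ifs_word r b w ` {0..1}"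
  shows "\<bar>x - y\<bar> \<le> r ^ length w"
proof -
  obtain x' y' where xy: "x' \<in> {0..1}" "y' \<in> {0..1}" "x = ifs_word r b w x'" "y = ifs_word r b w y'"
    using assms by blast
  then have "\<bar>x - y\<bar> = r ^ length w * \<bar>x' - y'\<bar>"
    using r_pos by (simp add: ifs_word_diff abs_mult)
  also have "\<dots> \<le> r ^ length w * 1"
    using xy r_pos by (intro mult_left_mono) auto
  finally show ?thesis by simp
qed

lemma Inter_cylinders:
  assumes "j \<in> binary_seqs"
  shows "(\<Inter>n\<in>{1..}. ifs_word r b (map j [0..<n]) ` {0..1}) = {code_proj r b j}"
proof (intro equalityI subsetI)
  fix y assume y: "y \<in> (\<Inter>n\<in>{1..}. ifs_word r b (map j [0..<n]) ` {0..1})"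
  have "\<bar>y - code_proj r b j\<bar> \<le> r ^ n" if "n \<ge> 1" for n
    using cylinder_dist[of y "map j [0..<n]" "code_proj r b j"] y that
      code_proj_in_cylinder[OF assms, of n] by auto
  moreover have "(\<lambda>n. r ^ n) \<longlonglongrightarrow> 0"
    using r_pos r_half by (intro LIMSEQ_realpow_zero) auto
  ultimately have "\<bar>y - code_proj r b j\<bar> \<le> 0"
    by (intro LIMSEQ_le_const) auto
  then show "y \<in> {code_proj r b j}" by simp
next
  fix y assume "y \<in> {code_proj r b j}"
  then show "y \<in> (\<Inter>n\<in>{1..}. ifs_word r b (map j [0..<n]) ` {0..1})"
    using code_proj_in_cylinder[OF assms] by blast
qed

text \<open>
  A branch determines a nested sequence of cylinders whose common point is the coding of its label
  sequence, so only the set of label sequences matters.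
\<close>

lemma tree_fractal_eq_image:
  assumes "m \<ge> 3" "2 ^ (L + 1) \<le> m + 1" "m + 1 < 2 ^ (L + 2)"
  shows "tree_fractal r b m = code_proj r b ` {j \<in> binary_seqs. gapped L L j}"
proof -
  have labels: "map (\<lambda>k. tree_label m (seq_prefix t k)) [1..<Suc n] = map (label_seq m t) [0..<n]" for t n
    unfolding One_nat_def map_Suc_upt[symmetric] by (simp add: label_seq_def)
  have "tree_fractal r b m = (\<lambda>t. code_proj r b (label_seq m t)) ` (UNIV \<rightarrow> {1, 2})"
    unfolding tree_fractal_def labels
    using Inter_cylinders[OF label_seq_gapped(1)[OF _ assms(2)]] by auto
  also have "\<dots> = code_proj r b ` (label_seq m ` (UNIV \<rightarrow> {1, 2}))"
    by (simp add: image_image)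
  also have "label_seq m ` (UNIV \<rightarrow> {1, 2}) = {j \<in> binary_seqs. gapped L L j}"
    using label_seq_gapped[OF _ assms(2)] gapped_is_label_seq[OF assms] by blast
  finally show ?thesis .
qed

text \<open>
  After the first difference the most unfavourable tails, ones in \<open>j\<close> and zeros in \<open>j'\<close>, contribute
  \<open>- r / (1 - r)\<close>.  Splitting this off leaves a sum of nonnegative terms and the constant
  \<open>1 - r / (1 - r) = (1 - 2 r) / (1 - r)\<close>, so that equality can be read off.
\<close>

lemma code_proj_diff:
  assumes j: "j \<in> binary_seqs" "j' \<in> binary_seqs"
    and eq: "\<And>k. k < n \<Longrightarrow> j k = j' k" and n: "j n = 0" "j' n = 1"
  shows "summable (\<lambda>k. (1 + real (j' (k + Suc n)) - real (j (k + Suc n))) * r ^ Suc k)"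
    and "code_proj r b j' - code_proj r b j = (b 1 - b 0) * r ^ n *
      ((1 - 2 * r) / (1 - r) + (\<Sum>k. (1 + real (j' (k + Suc n)) - real (j (k + Suc n))) * r ^ Suc k))"
proof -
  let ?c = "b 1 - b 0"
  let ?d = "\<lambda>k. real (j' k) - real (j k)"
  let ?D = "\<lambda>k. b (j' k) * r ^ k - b (j k) * r ^ k"
  have c: "?c > 0" using translation_bounds(3) r_pos by simp
  have D: "?D k = ?c * ?d k * r ^ k" for k
    unfolding b_binary[OF j(1), of k] b_binary[OF j(2), of k] by (simp add: algebra_simps)
  have sD: "summable ?D"
    by (intro summable_diff summable_proj j)
  have geo: "(\<lambda>k. r ^ Suc k) sums (r / (1 - r))"
    using sums_mult[OF geometric_sums[of r], of r] r_pos r_half by simp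
  have "summable (\<lambda>k. ?D (k + Suc n) / (?c * r ^ n))"
    by (intro summable_divide summable_ignore_initial_segment sD)
  moreover have E: "?D (k + Suc n) / (?c * r ^ n) = ?d (k + Suc n) * r ^ Suc k" for k
    unfolding D using c r_pos by (simp add: power_add field_simps)
  ultimately have sE: "summable (\<lambda>k. ?d (k + Suc n) * r ^ Suc k)" by (simp only:)
  have split: "(1 + real (j' (k + Suc n)) - real (j (k + Suc n))) * r ^ Suc k
      = r ^ Suc k + ?d (k + Suc n) * r ^ Suc k" for k
    by (simp add: algebra_simps)
  show "summable (\<lambda>k. (1 + real (j' (k + Suc n)) - real (j (k + Suc n))) * r ^ Suc k)"
    unfolding split by (intro summable_add sums_summable[OF geo] sE)
  have "code_proj r b j' - code_proj r b j = suminf ?D"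
    by (simp add: code_proj_sum j suminf_diff[symmetric] summable_proj)
  also have "\<dots> = (\<Sum>k. ?D (k + Suc n)) + sum ?D {..<Suc n}"
    by (rule suminf_split_initial_segment[OF sD])
  also have "sum ?D {..<Suc n} = ?c * r ^ n"
    using eq n by (simp add: left_diff_distrib)
  also have "(\<Sum>k. ?D (k + Suc n)) = ?c * r ^ n * (\<Sum>k. ?d (k + Suc n) * r ^ Suc k)"
  proof -
    have "?D (k + Suc n) = ?c * r ^ n * (?d (k + Suc n) * r ^ Suc k)" for k
      unfolding D by (simp add: power_add mult_ac)
    then show ?thesis using suminf_mult[OF sE, of "?c * r ^ n"] by (simp only:)
  qed
  also have "(\<Sum>k. ?d (k + Suc n) * r ^ Suc k)
      = (\<Sum>k. (1 + real (j' (k + Suc n)) - real (j (k + Suc n))) * r ^ Suc k) - r / (1 - r)"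
    unfolding split using suminf_add[OF sums_summable[OF geo] sE] sums_unique[OF geo] by simp
  finally show "code_proj r b j' - code_proj r b j = ?c * r ^ n *
      ((1 - 2 * r) / (1 - r) + (\<Sum>k. (1 + real (j' (k + Suc n)) - real (j (k + Suc n))) * r ^ Suc k))"
    using r_half by (simp add: field_simps)
qed

lemma code_proj_eq_first_diff:
  assumes j: "j \<in> binary_seqs" "j' \<in> binary_seqs"
    and eq: "\<And>k. k < n \<Longrightarrow> j k = j' k" and n: "j n = 0" "j' n = 1"
  shows "code_proj r b j = code_proj r b j' \<longleftrightarrow> r = 1 / 2 \<and> dyadic_twin j' j"
proof -
  let ?t = "\<lambda>k. (1 + real (j' (k + Suc n)) - real (j (k + Suc n))) * r ^ Suc k"
  note diff = code_proj_diff[OF j eq n]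
  have bin: "j k \<in> {0, 1}" "j' k \<in> {0, 1}" for k
    using j by (auto simp: binary_seqs_iff)
  have nonneg: "0 \<le> ?t k" for k
    using bin[of "k + Suc n"] r_pos by auto
  have t0: "?t k = 0 \<longleftrightarrow> j' (k + Suc n) = 0 \<and> j (k + Suc n) = 1" for k
    using bin[of "k + Suc n"] r_pos by auto
  have "0 < (b 1 - b 0) * r ^ n" using translation_bounds(3) r_pos by simp
  then have nz: "(b 1 - b 0) * r ^ n \<noteq> 0" by linarith
  have "code_proj r b j = code_proj r b j' \<longleftrightarrow> code_proj r b j' - code_proj r b j = 0"
    by auto
  also have "\<dots> \<longleftrightarrow> (1 - 2 * r) / (1 - r) + suminf ?t = 0"
  proof -
    have "code_proj r b j' - code_proj r b j = (b 1 - b 0) * r ^ n * ((1 - 2 * r) / (1 - r) + suminf ?t)"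
      by (rule diff(2))
    then show ?thesis using nz by (simp only: mult_eq_0_iff[of "(b 1 - b 0) * r ^ n"] simp_thms)
  qed
  also have "\<dots> \<longleftrightarrow> (1 - 2 * r) / (1 - r) = 0 \<and> suminf ?t = 0"
    using suminf_nonneg[OF diff(1) nonneg] r_half by (intro add_nonneg_eq_0_iff) auto
  also have "suminf ?t = 0 \<longleftrightarrow> (\<forall>k. ?t k = 0)"
    by (rule suminf_eq_zero_iff[OF diff(1) nonneg])
  also have "\<dots> \<longleftrightarrow> (\<forall>k>n. j' k = 0 \<and> j k = 1)"
  proof (intro iffI allI impI)
    fix k assume *: "\<forall>k. ?t k = 0" and "n < k"
    then have "?t (k - Suc n) = 0" by blast
    with \<open>n < k\<close> show "j' k = 0 \<and> j k = 1" unfolding t0 by simp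
  next
    fix k assume "\<forall>k>n. j' k = 0 \<and> j k = 1"
    then show "?t k = 0" unfolding t0 by simp
  qed
  also have "\<dots> \<longleftrightarrow> dyadic_twin j' j"
  proof
    assume "dyadic_twin j' j"
    then obtain i where i: "\<forall>k<i. j k = j' k" "j' i = 1" "j i = 0" "\<forall>k>i. j' k = 0 \<and> j k = 1"
      by (auto simp: dyadic_twin_def)
    have "i = n"
      using i n eq by (cases i n rule: linorder_cases) auto
    with i show "\<forall>k>n. j' k = 0 \<and> j k = 1" by blast
  next
    assume "\<forall>k>n. j' k = 0 \<and> j k = 1"
    then show "dyadic_twin j' j"
      unfolding dyadic_twin_def using eq n by blast
  qed
  also have "(1 - 2 * r) / (1 - r) = 0 \<longleftrightarrow> r = 1 / 2"
    using r_half by auto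
  finally show ?thesis .
qed

lemma code_proj_eq_iff:
  assumes j: "j \<in> binary_seqs" "j' \<in> binary_seqs"
  shows "code_proj r b j = code_proj r b j' \<longleftrightarrow>
    j = j' \<or> r = 1 / 2 \<and> (dyadic_twin j' j \<or> dyadic_twin j j')"
proof (cases "j = j'")
  case False
  define n where "n = (LEAST n. j n \<noteq> j' n)"
  obtain i where "j i \<noteq> j' i"
    using False by auto
  then have n: "j n \<noteq> j' n"
    unfolding n_def by (rule LeastI)
  have eq: "j k = j' k" if "k < n" for k
    using not_less_Least[of k "\<lambda>n. j n \<noteq> j' n"] that by (auto simp: n_def)
  have "j n \<in> {0, 1}" "j' n \<in> {0, 1}"
    using j by (auto simp: binary_seqs_iff)
  with n consider "j n = 0" "j' n = 1" | "j n = 1" "j' n = 0" by auto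
  then show ?thesis
  proof cases
    case 1
    have "\<not> dyadic_twin j j'"
    proof
      assume "dyadic_twin j j'"
      then obtain i where "\<forall>k<i. j' k = j k" "j i = 1" "j' i = 0"
        by (auto simp: dyadic_twin_def)
      with 1 eq show False by (cases i n rule: linorder_cases) auto
    qed
    with False code_proj_eq_first_diff[OF j eq 1] show ?thesis by blast
  next
    case 2
    have "\<not> dyadic_twin j' j"
    proof
      assume "dyadic_twin j' j"
      then obtain i where "\<forall>k<i. j k = j' k" "j' i = 1" "j i = 0"
        by (auto simp: dyadic_twin_def)
      with 2 eq show False by (cases i n rule: linorder_cases) auto
    qed
    with False code_proj_eq_first_diff[OF j(2,1) eq[symmetric] 2(2,1)] show ?thesis by metis
  qed
qed simp

text \<open>
  Sequences in \<open>S\<close> have no tail of ones, so they can only be the twin that ends in zeros.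
\<close>

lemma code_proj_vimage:
  assumes S: "S \<subseteq> binary_seqs" "\<And>j i. j \<in> S \<Longrightarrow> \<exists>k>i. j k = 0"
  shows "r < 1 / 2 \<Longrightarrow> {j \<in> binary_seqs. code_proj r b j \<in> code_proj r b ` S} = S"
    and "r = 1 / 2 \<Longrightarrow> {j \<in> binary_seqs. code_proj r b j \<in> code_proj r b ` S}
      = S \<union> {j. \<exists>j'\<in>S. dyadic_twin j' j}"
proof -
  have no: "\<not> dyadic_twin j j'" if "j' \<in> S" for j j'
    using S(2)[OF that] by (force simp: dyadic_twin_def)
  have bin: "j \<in> binary_seqs" if tw: "dyadic_twin j' j" and j': "j' \<in> S" for j j'
  proof -
    obtain n where n: "\<forall>k<n. j k = j' k" "j n = 0" "\<forall>k>n. j k = 1"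
      using tw unfolding dyadic_twin_def by auto
    have "j k \<in> {0, 1}" for k
    proof (cases k n rule: linorder_cases)
      case less
      with n(1) j' S(1) binary_seqs_iff[of j'] show ?thesis by (metis insertCI subsetD)
    qed (use n in auto)
    then show ?thesis by (simp add: binary_seqs_iff)
  qed
  show "{j \<in> binary_seqs. code_proj r b j \<in> code_proj r b ` S} = S" if "r < 1 / 2"
    using S(1) code_proj_eq_iff that by (auto simp: subset_iff)
  show "{j \<in> binary_seqs. code_proj r b j \<in> code_proj r b ` S}
      = S \<union> {j. \<exists>j'\<in>S. dyadic_twin j' j}" (is "?A = ?B") if "r = 1 / 2"
  proof (intro equalityI subsetI)
    fix j assume "j \<in> ?A"
    then obtain j' where "j \<in> binary_seqs" "j' \<in> S" "code_proj r b j = code_proj r b j'" by auto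
    with S(1) code_proj_eq_iff[of j j'] no show "j \<in> ?B" by blast
  next
    fix j assume "j \<in> ?B"
    then consider "j \<in> S" | j' where "j' \<in> S" "dyadic_twin j' j" by blast
    then show "j \<in> ?A"
    proof cases
      case 2
      have "j \<in> binary_seqs" "j' \<in> binary_seqs" using bin 2 S(1) by auto
      moreover from this have "code_proj r b j = code_proj r b j'"
        using code_proj_eq_iff[of j j'] 2 that by blast
      ultimately show ?thesis using 2 by blast
    qed (use S in auto)
  qed
qed

end

section \<open>Weights on words\<close>

definition binary_words :: "nat \<Rightarrow> nat list set" where
  "binary_words n = {w. set w \<subseteq> {0, 1} \<and> length w = n}"

lemma finite_binary_words: "finite (binary_words n)"
  unfolding binary_words_def by (rule finite_lists_length_eq) simp

lemma binary_words_0: "binary_words 0 = {[]}"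
  by (auto simp: binary_words_def)

lemma binary_words_Suc: "binary_words (Suc n) = (#) 0 ` binary_words n \<union> (#) 1 ` binary_words n"
  by (auto simp: binary_words_def length_Suc_conv)

lemma sum_binary_words_Suc:
  "(\<Sum>w\<in>binary_words (Suc n). f w)
    = (\<Sum>w\<in>binary_words n. f (0 # w)) + (\<Sum>w\<in>binary_words n. f (1 # w))"
  unfolding binary_words_Suc
  by (subst sum.union_disjoint) (auto simp: finite_binary_words sum.reindex)

lemma prefix_in_binary_words: "j \<in> binary_seqs \<Longrightarrow> map j [0..<n] \<in> binary_words n"
  by (force simp: binary_seqs_iff binary_words_def)

lemma map_upt_Suc_shift: "map j [0..<Suc n] = j 0 # map (\<lambda>k. j (Suc k)) [0..<n]"
  by (simp add: upt_conv_Cons map_Suc_upt[symmetric] del: upt_Suc)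

text \<open>
  The state \<open>t\<close> counts the zeros that must still be read before a 1 is permitted.  An admissible word
  of length \<open>n\<close> that ends in state \<open>t'\<close> gets \<open>q\<^bsup>n+t'\<^esup>\<close>, every other word 0.  If \<open>q + q\<^bsup>L+1\<^esup> = 1\<close>,
  this is \<open>q\<^sup>t\<close> times the probability of the word under the Markov chain that starts in state \<open>t\<close>
  and has the transition probabilities of the measure of maximal entropy.
\<close>

fun gap_mass :: "nat \<Rightarrow> real \<Rightarrow> nat \<Rightarrow> nat list \<Rightarrow> real" where
  "gap_mass L q t [] = q ^ t"
| "gap_mass L q t (a # w) =
     q * (if a = 0 then gap_mass L q (t - 1) w else if t = 0 then gap_mass L q L w else 0)"

context
  fixes L :: nat and q :: real
  assumes q_pos: "0 < q" and q_root: "q + q ^ Suc L = 1"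
begin

lemma q_less_1: "q < 1"
  using q_root zero_less_power[OF q_pos, of "Suc L"] by linarith

lemma gap_mass_nonneg: "0 \<le> gap_mass L q t w"
  using q_pos by (induction w arbitrary: t) auto

text \<open>
  The weights are additive.  In a state \<open>t > 0\<close> the only admissible letter is 0, and \<open>q * q\<^bsup>t-1\<^esup> = q\<^sup>t\<close>;
  in state 0 both letters are, and additivity is the equation \<open>q + q * q\<^sup>L = 1\<close>.
\<close>

lemma sum_gap_mass: "(\<Sum>w\<in>binary_words n. gap_mass L q t w) = q ^ t"
proof (induction n arbitrary: t)
  case (Suc n)
  have "q + q * q ^ L = 1" using q_root by simp
  with Suc show ?case
    by (cases t) (simp_all add: sum_binary_words_Suc sum_distrib_left[symmetric])
qed (simp add: binary_words_0)

lemma sum_gap_mass_append: "(\<Sum>w\<in>binary_words n. gap_mass L q t (v @ w)) = gap_mass L q t v"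
  by (induction v arbitrary: t) (simp_all add: sum_gap_mass sum_distrib_left[symmetric])

lemma gap_mass_le: "gap_mass L q t w \<le> q ^ length w"
proof (induction w arbitrary: t)
  case Nil
  show ?case using q_less_1 q_pos by (simp add: power_le_one)
qed (use q_pos in auto)

lemma gap_mass_ge:
  assumes "t \<le> L" "gap_mass L q t w \<noteq> 0"
  shows "q ^ (length w + L) \<le> gap_mass L q t w"
  using assms
proof (induction w arbitrary: t)
  case Nil
  then show ?case using q_less_1 q_pos by (simp add: power_decreasing)
next
  case (Cons a w)
  from Cons.prems have "a = 0 \<and> gap_mass L q (t - 1) w \<noteq> 0 \<or> a \<noteq> 0 \<and> t = 0 \<and> gap_mass L q L w \<noteq> 0"
    by (auto split: if_splits)
  with Cons.IH[of "t - 1"] Cons.IH[of L] Cons.prems(1) q_pos show ?case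
    by auto
qed

lemma card_positive_gap_mass:
  "card {w \<in> binary_words n. gap_mass L q L w \<noteq> 0} * q ^ n \<le> 1"
proof -
  let ?A = "{w \<in> binary_words n. gap_mass L q L w \<noteq> 0}"
  have "card ?A * q ^ (n + L) = (\<Sum>w\<in>?A. q ^ (n + L))" by simp
  also have "\<dots> \<le> (\<Sum>w\<in>?A. gap_mass L q L w)"
    using gap_mass_ge[of L] by (intro sum_mono) (auto simp: binary_words_def)
  also have "\<dots> \<le> (\<Sum>w\<in>binary_words n. gap_mass L q L w)"
    using gap_mass_nonneg by (intro sum_mono2) (auto simp: finite_binary_words)
  also have "\<dots> = q ^ L" by (rule sum_gap_mass)
  finally have "(card ?A * q ^ n) * q ^ L \<le> 1 * q ^ L" by (simp add: power_add mult_ac)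
  then show ?thesis using q_pos by simp
qed

text \<open>
  Removing the first letter of a gapped sequence follows the same transitions of the state as
  \<^const>\<open>gap_mass\<close>.  This links the combinatorial condition to words of positive weight.
\<close>

lemma gapped_Suc_iff:
  assumes "j \<in> binary_seqs" "t \<le> L"
  shows "gapped L t j \<longleftrightarrow>
    (if j 0 = 0 then gapped L (t - 1) (\<lambda>k. j (Suc k)) else t = 0 \<and> gapped L L (\<lambda>k. j (Suc k)))"
proof -
  have j0: "j 0 = 0 \<or> j 0 = 1" using assms(1) by (auto simp: binary_seqs_iff)
  have *: "gapped L t j \<longleftrightarrow> (j 0 = 1 \<longrightarrow> t = 0) \<and>
      (\<forall>n. j (Suc n) = 1 \<longrightarrow> t \<le> Suc n \<and> (j 0 = 1 \<longrightarrow> L < Suc n)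
        \<and> (\<forall>k<n. j (Suc k) = 1 \<longrightarrow> k + L < n))"
  proof
    assume g: "gapped L t j"
    show "(j 0 = 1 \<longrightarrow> t = 0) \<and> (\<forall>n. j (Suc n) = 1 \<longrightarrow> t \<le> Suc n \<and>
      (j 0 = 1 \<longrightarrow> L < Suc n) \<and> (\<forall>k<n. j (Suc k) = 1 \<longrightarrow> k + L < n))"
    proof (intro conjI allI impI)
      show "t = 0" if "j 0 = 1"
        using g that by (auto simp: gapped_def)
      fix n assume n: "j (Suc n) = 1"
      with g have *: "t \<le> Suc n" "\<And>k. k < Suc n \<Longrightarrow> j k = 1 \<Longrightarrow> k + L < Suc n"
        by (auto simp: gapped_def)
      show "t \<le> Suc n" by fact
      show "L < Suc n" if "j 0 = 1" using *(2)[of 0] that by simp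
      show "k + L < n" if "k < n" "j (Suc k) = 1" for k using *(2)[of "Suc k"] that by simp
    qed
  next
    assume g: "(j 0 = 1 \<longrightarrow> t = 0) \<and> (\<forall>n. j (Suc n) = 1 \<longrightarrow> t \<le> Suc n \<and>
      (j 0 = 1 \<longrightarrow> L < Suc n) \<and> (\<forall>k<n. j (Suc k) = 1 \<longrightarrow> k + L < n))"
    show "gapped L t j"
      unfolding gapped_def
    proof (intro allI impI)
      fix n assume "j n = 1"
      with g show "t \<le> n \<and> (\<forall>k<n. j k = 1 \<longrightarrow> k + L < n)"
        by (cases n) (auto simp: less_Suc_eq_0_disj)
    qed
  qed
  show ?thesis
    using j0 unfolding * by (auto simp: gapped_def)
qed

lemma gap_mass_prefix_pos:
  assumes "j \<in> binary_seqs" "gapped L t j" "t \<le> L"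
  shows "0 < gap_mass L q t (map j [0..<n])"
  using assms
proof (induction n arbitrary: j t)
  case 0
  then show ?case using q_pos by simp
next
  case (Suc n)
  have bin: "(\<lambda>k. j (Suc k)) \<in> binary_seqs" using Suc.prems(1) by (auto simp: binary_seqs_iff)
  show ?case
    using Suc.prems Suc.IH[OF bin, of "t - 1"] Suc.IH[OF bin, of L] q_pos
    unfolding map_upt_Suc_shift
    by (auto simp: gapped_Suc_iff[OF Suc.prems(1,3)] split: if_splits)
qed

text \<open>
  Appending zeros never violates the gap condition.
\<close>

lemma gap_mass_pos_extends:
  assumes "set w \<subseteq> {0, 1}" "gap_mass L q t w \<noteq> 0" "t \<le> L"
  shows "\<exists>j\<in>binary_seqs. gapped L t j \<and> map j [0..<length w] = w"
  using assms
proof (induction w arbitrary: t)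
  case Nil
  show ?case by (intro bexI[of _ "\<lambda>_. 0"]) (auto simp: gapped_def binary_seqs_iff)
next
  case (Cons a w)
  define s where "s = (if a = 0 then t - 1 else L)"
  have "gap_mass L q s w \<noteq> 0" "s \<le> L" "a \<noteq> 0 \<Longrightarrow> t = 0"
    using Cons.prems by (auto simp: s_def split: if_splits)
  with Cons obtain i where i: "i \<in> binary_seqs" "gapped L s i" "map i [0..<length w] = w"
    by (metis insert_subset list.simps(15))
  define j where "j = (\<lambda>k. case k of 0 \<Rightarrow> a | Suc k' \<Rightarrow> i k')"
  have j: "j \<in> binary_seqs"
    using i(1) Cons.prems(1) by (auto simp: binary_seqs_iff j_def split: nat.splits)
  have gapped: "gapped L t j"
    using i(2) \<open>a \<noteq> 0 \<Longrightarrow> t = 0\<close> unfolding gapped_Suc_iff[OF j Cons.prems(3)]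
    by (auto simp: j_def s_def split: if_splits)
  have prefix: "map j [0..<length (a # w)] = a # w"
    unfolding list.size(4) add_0_right One_nat_def add_Suc_right map_upt_Suc_shift using i(3)
    by (simp add: j_def)
  show ?case
  proof (intro bexI[of _ j] conjI)
  qed fact+
qed

end

section \<open>Bounds for Hausdorff measures\<close>

lemma hausdorff_gauge_pos: "0 < s \<Longrightarrow> hausdorff_gauge s U = ennreal (diameter U powr s)"
  by (auto simp: hausdorff_gauge_def)

lemma hausdorff_premeasure_le_finite_cover:
  fixes A :: "'a::metric_space set"
  assumes "0 < s" "0 \<le> \<delta>" and fin: "finite I" "A \<subseteq> (\<Union>i\<in>I. u i)"
    and u: "\<And>i. i \<in> I \<Longrightarrow> bounded (u i) \<and> diameter (u i) \<le> \<delta>"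
  shows "hausdorff_premeasure \<delta> s A \<le> ennreal (\<Sum>i\<in>I. diameter (u i) powr s)"
proof -
  obtain h where h: "bij_betw h {..<card I} I"
    using ex_bij_betw_nat_finite[OF fin(1)] by (auto simp: atLeast0LessThan)
  define U where "U n = (if n < card I then u (h n) else {})" for n
  have hI: "h n \<in> I" if "n < card I" for n
    using h that by (auto simp: bij_betw_def)
  have "A \<subseteq> (\<Union>n. U n)"
  proof
    fix x assume "x \<in> A"
    then obtain i where i: "i \<in> I" "x \<in> u i" using fin(2) by blast
    then have "i \<in> h ` {..<card I}" using bij_betw_imp_surj_on[OF h] by simp
    then obtain n where "n < card I" "h n = i" by (elim imageE) simp
    then show "x \<in> (\<Union>n. U n)" using i(2) by (auto simp: U_def)
  qed
  moreover have "bounded (U n) \<and> diameter (U n) \<le> \<delta>" for n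
    using u hI \<open>0 \<le> \<delta>\<close> by (auto simp: U_def)
  ultimately have "hausdorff_premeasure \<delta> s A \<le> (\<Sum>n. hausdorff_gauge s (U n))"
    unfolding hausdorff_premeasure_def by (intro INF_lower) auto
  also have "\<dots> = (\<Sum>n<card I. hausdorff_gauge s (U n))"
    by (intro suminf_finite) (auto simp: U_def hausdorff_gauge_def)
  also have "\<dots> = (\<Sum>n<card I. ennreal (diameter (u (h n)) powr s))"
    using \<open>0 < s\<close> by (intro sum.cong) (auto simp: U_def hausdorff_gauge_pos)
  also have "\<dots> = (\<Sum>i\<in>I. ennreal (diameter (u i) powr s))"
    by (rule sum.reindex_bij_betw[OF h])
  also have "\<dots> = ennreal (\<Sum>i\<in>I. diameter (u i) powr s)"
    by (rule sum_ennreal) simp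
  finally show ?thesis .
qed

lemma powr_enlarge:
  fixes d s \<epsilon> :: real
  assumes "0 \<le> d" "0 < s" "0 < \<epsilon>"
  shows "\<exists>e>d. e powr s \<le> d powr s + \<epsilon>"
proof -
  define e where "e = (d powr s + \<epsilon>) powr (1 / s)"
  have pos: "0 < d powr s + \<epsilon>" using assms by (simp add: add_nonneg_pos)
  have "e powr s = d powr s + \<epsilon>"
    using assms pos by (simp add: e_def powr_powr)
  moreover have "d < e"
  proof (rule ccontr)
    assume "\<not> d < e"
    then have "e powr s \<le> d powr s"
      using assms by (intro powr_mono2) (auto simp: e_def)
    with calculation assms show False by simp
  qed
  ultimately show ?thesis by auto
qed

text \<open>
  For compact sets a lower bound for finite covers by balls suffices, and the mass distribution
  principle can then be applied with sums over words in place of a measure.  Each set of an arbitrary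
  cover is enlarged to an open ball around one of its points; the total error in the sum of the powers
  is \<open>\<eta> / (2 K)\<close>, which halves the bound.  The scale \<open>\<delta> = 1\<close> is taken because diameters at most 1 make
  the powers with a smaller exponent \<open>s'\<close> larger, so that one exponent \<open>s\<close> serves for all.
\<close>

lemma hausdorff_premeasure_ge_of_ball_covers:
  fixes F :: "'a::metric_space set"
  assumes "compact F" and s: "0 < s" "0 \<le> s'" "s' \<le> s" and K: "0 < K" and \<eta>: "0 < \<eta>"
    and covers: "\<And>N x e. finite N \<Longrightarrow> (\<And>n::nat. n \<in> N \<Longrightarrow> 0 < e n) \<Longrightarrow>
      F \<subseteq> (\<Union>n\<in>N. ball (x n) (e n)) \<Longrightarrow> \<eta> \<le> K * (\<Sum>n\<in>N. e n powr s)"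
  shows "ennreal (\<eta> / (2 * K)) \<le> hausdorff_premeasure 1 s' F"
  unfolding hausdorff_premeasure_def
proof (rule INF_greatest)
  fix U :: "nat \<Rightarrow> 'a set"
  assume "U \<in> {U. F \<subseteq> (\<Union>n. U n) \<and> (\<forall>n. bounded (U n) \<and> diameter (U n) \<le> 1)}"
  then have cov: "F \<subseteq> (\<Union>n. U n)" and bd: "\<And>n. bounded (U n)" and d1: "\<And>n. diameter (U n) \<le> 1"
    by auto
  let ?\<epsilon> = "\<lambda>n. \<eta> / (2 * K) * (1 / 2) ^ Suc n"
  have "\<exists>e>diameter (U n). e powr s \<le> diameter (U n) powr s + ?\<epsilon> n" for n
    using s K \<eta> by (intro powr_enlarge diameter_ge_0 bd) auto
  then obtain e where e: "\<And>n. diameter (U n) < e n" "\<And>n. e n powr s \<le> diameter (U n) powr s + ?\<epsilon> n"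
    by metis
  define x where "x n = (SOME y. y \<in> U n)" for n
  have "U n \<subseteq> ball (x n) (e n)" if "U n \<noteq> {}" for n
  proof
    fix y assume "y \<in> U n"
    have "x n \<in> U n" using that by (auto simp: x_def intro: someI)
    then have "dist (x n) y \<le> diameter (U n)"
      using \<open>y \<in> U n\<close> by (intro diameter_bounded_bound bd)
    with e(1)[of n] show "y \<in> ball (x n) (e n)" by simp
  qed
  then have "y \<in> (\<Union>n\<in>{n. U n \<noteq> {}}. ball (x n) (e n))" if "y \<in> F" for y
    using subsetD[OF cov that] by force
  then have cover_nonempty: "F \<subseteq> (\<Union>n\<in>{n. U n \<noteq> {}}. ball (x n) (e n))"
    by (rule subsetI)
  obtain N where N: "N \<subseteq> {n. U n \<noteq> {}}" "finite N" "F \<subseteq> (\<Union>n\<in>N. ball (x n) (e n))"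
    by (rule compactE_image[OF \<open>compact F\<close> open_ball cover_nonempty])
  have "0 < e n" for n
    using e(1)[of n] diameter_ge_0[OF bd, of n] by simp
  then have "\<eta> \<le> K * (\<Sum>n\<in>N. e n powr s)"
    using covers[OF N(2) _ N(3)] by blast
  also have "\<dots> \<le> K * (\<Sum>n\<in>N. diameter (U n) powr s + ?\<epsilon> n)"
    using e K by (intro mult_left_mono sum_mono) auto
  also have "\<dots> = K * (\<Sum>n\<in>N. diameter (U n) powr s) + \<eta> / 2 * (\<Sum>n\<in>N. (1 / 2) ^ Suc n)"
    using K by (simp add: sum.distrib distrib_left sum_distrib_left del: power_Suc)
  also have "(\<Sum>n\<in>N. (1 / 2) ^ Suc n) \<le> (1::real)"
    using sum_le_suminf[OF sums_summable[OF power_half_series] N(2)]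
    unfolding sums_unique[OF power_half_series, symmetric] by (metis zero_le_power zero_le_divide_1_iff zero_le_numeral)
  finally have "\<eta> / (2 * K) \<le> (\<Sum>n\<in>N. diameter (U n) powr s)"
    using K \<eta> by (simp add: field_simps)
  then have "ennreal (\<eta> / (2 * K)) \<le> ennreal (\<Sum>n\<in>N. diameter (U n) powr s)"
    by (rule ennreal_leI)
  also have "\<dots> = (\<Sum>n\<in>N. ennreal (diameter (U n) powr s))"
    by (rule sum_ennreal[symmetric]) simp
  also have "\<dots> \<le> (\<Sum>n\<in>N. hausdorff_gauge s' (U n))"
  proof (rule sum_mono)
    fix n assume "n \<in> N"
    then have "U n \<noteq> {}" using N(1) by blast
    have dn: "0 \<le> diameter (U n)" by (rule diameter_ge_0[OF bd])
    show "ennreal (diameter (U n) powr s) \<le> hausdorff_gauge s' (U n)"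
    proof (cases "s' = 0")
      case True
      have "diameter (U n) powr s \<le> 1"
        using dn d1[of n] s by (intro powr_le1) auto
      then show ?thesis using True \<open>U n \<noteq> {}\<close> by (simp add: hausdorff_gauge_def)
    next
      case False
      have "diameter (U n) powr s \<le> diameter (U n) powr s'"
        using s dn d1[of n] by (intro powr_mono') auto
      then show ?thesis using False s by (simp add: hausdorff_gauge_pos ennreal_leI)
    qed
  qed
  also have "\<dots> \<le> (\<Sum>n. hausdorff_gauge s' (U n))"
    by (intro sum_le_suminf) (auto simp: N)
  finally show "ennreal (\<eta> / (2 * K)) \<le> (\<Sum>n. hausdorff_gauge s' (U n))" .
qed

lemma hausdorff_dim_eqI:
  assumes "0 < d" and above: "\<And>s. d < s \<Longrightarrow> hausdorff_measure s A = 0"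
    and below: "\<And>s. 0 \<le> s \<Longrightarrow> s < d \<Longrightarrow> hausdorff_measure s A \<noteq> 0"
  shows "hausdorff_dim A = ereal d"
  unfolding hausdorff_dim_def
proof (rule antisym)
  show "ereal d \<le> (INF s\<in>{s. 0 \<le> s \<and> hausdorff_measure s A = 0}. ereal s)"
    using below by (intro INF_greatest) (force simp: not_less[symmetric])
  show "(INF s\<in>{s. 0 \<le> s \<and> hausdorff_measure s A = 0}. ereal s) \<le> ereal d"
  proof (rule ereal_le_epsilon2)
    fix e :: real assume "0 < e"
    then have "(INF s\<in>{s. 0 \<le> s \<and> hausdorff_measure s A = 0}. ereal s) \<le> ereal (d + e)"
      using above \<open>0 < d\<close> by (intro INF_lower) auto
    then show "(INF s\<in>{s. 0 \<le> s \<and> hausdorff_measure s A = 0}. ereal s) \<le> ereal d + ereal e"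
      by simp
  qed
qed

context two_map_ifs
begin

section \<open>The dimension of the coded gapped sequences\<close>

lemma left_endpoints_separated:
  assumes "v \<in> binary_words n" "w \<in> binary_words n" "v \<noteq> w"
  shows "r ^ n \<le> \<bar>ifs_word r b v 0 - ifs_word r b w 0\<bar>"
  using assms
proof (induction n arbitrary: v w)
  case 0
  then show ?case by (simp add: binary_words_0)
next
  case (Suc n)
  have apart: "r ^ Suc n \<le> ifs_word r b (1 # w) 0 - ifs_word r b (0 # v) 0"
    if "v \<in> binary_words n" "w \<in> binary_words n" for v w
  proof -
    have "0 \<le> ifs_word r b w 0" "ifs_word r b v 1 \<le> 1"
      using ifs_word_in_unit[of w 0] ifs_word_in_unit[of v 1] that by (auto simp: binary_words_def)
    moreover have "ifs_word r b v 1 - ifs_word r b v 0 = r ^ n"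
      using that by (simp add: ifs_word_diff binary_words_def)
    ultimately have "r ^ n \<le> ifs_word r b w 0 - ifs_word r b v 0 + 1" by linarith
    then have "r * r ^ n \<le> r * (ifs_word r b w 0 - ifs_word r b v 0 + 1)"
      using r_pos by (intro mult_left_mono) auto
    with translation_bounds(3) show ?thesis by (simp add: algebra_simps)
  qed
  obtain a v' c w' where vw: "v = a # v'" "w = c # w'" "a \<in> {0, 1}" "c \<in> {0, 1}"
    "v' \<in> binary_words n" "w' \<in> binary_words n"
    using Suc.prems(1,2) unfolding binary_words_Suc by blast
  show ?case
  proof (cases "a = c")
    case True
    then have "r ^ n \<le> \<bar>ifs_word r b v' 0 - ifs_word r b w' 0\<bar>"
      using Suc vw by blast
    then have "r * r ^ n \<le> r * \<bar>ifs_word r b v' 0 - ifs_word r b w' 0\<bar>"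
      using r_pos by (intro mult_left_mono) auto
    also have "\<dots> = \<bar>r * (ifs_word r b v' 0 - ifs_word r b w' 0)\<bar>"
      using r_pos by (simp add: abs_mult)
    finally show ?thesis
      using True vw by (simp add: algebra_simps)
  next
    case False
    then have "a = 0 \<and> c = 1 \<or> a = 1 \<and> c = 0" using vw by auto
    then show ?thesis
      using apart[OF vw(5,6)] apart[OF vw(6,5)] vw(1,2) by (auto simp del: ifs_word_Cons)
  qed
qed

text \<open>
  The left endpoints of the cylinders concerned lie in an open interval of length \<open>3 r\<^sup>n\<close> and are
  pairwise at least \<open>r\<^sup>n\<close> apart, so cutting that interval into three pieces of length \<open>r\<^sup>n\<close> separates
  them.
\<close>

lemma card_cylinders_meeting_ball:
  assumes "e \<le> r ^ n"
  shows "card {w \<in> binary_words n. ifs_word r b w ` {0..1} \<inter> ball x e \<noteq> {}} \<le> 3" (is "card ?B \<le> 3")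
proof -
  let ?f = "\<lambda>w. nat \<lfloor>(ifs_word r b w 0 - x + 2 * r ^ n) / r ^ n\<rfloor>"
  have rn: "0 < r ^ n" using r_pos by simp
  have range: "0 < ifs_word r b w 0 - x + 2 * r ^ n \<and> ifs_word r b w 0 - x + 2 * r ^ n < 3 * r ^ n"
    if w: "w \<in> ?B" for w
  proof -
    have "\<exists>y\<in>{0..1}. \<bar>x - ifs_word r b w y\<bar> < e"
      using w by (auto simp: dist_real_def)
    then obtain y where y: "y \<in> {0..1}" "\<bar>x - ifs_word r b w y\<bar> < e"
      by blast
    have "ifs_word r b w y - ifs_word r b w 0 = r ^ n * y"
      using w by (simp add: ifs_word_diff binary_words_def)
    moreover have "0 \<le> r ^ n * y" "r ^ n * y \<le> r ^ n * 1"
      using y(1) rn by (intro mult_nonneg_nonneg mult_left_mono; simp)+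
    ultimately show ?thesis using y(2) assms by linarith
  qed
  have "inj_on ?f ?B"
  proof (rule inj_onI, rule ccontr)
    fix v w assume vw: "v \<in> ?B" "w \<in> ?B" "?f v = ?f w" "v \<noteq> w"
    let ?p = "\<lambda>w. (ifs_word r b w 0 - x + 2 * r ^ n) / r ^ n"
    have "0 \<le> ?p v" "0 \<le> ?p w" using range[OF vw(1)] range[OF vw(2)] rn by auto
    then have "\<lfloor>?p v\<rfloor> = \<lfloor>?p w\<rfloor>" using vw(3) by (simp add: nat_eq_iff2)
    then have "\<bar>?p v - ?p w\<bar> < 1"
      using floor_correct[of "?p v"] floor_correct[of "?p w"] unfolding abs_less_iff by linarith
    moreover have "?p v - ?p w = (ifs_word r b v 0 - ifs_word r b w 0) / r ^ n"
      by (simp add: diff_divide_distrib[symmetric])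
    ultimately have "\<bar>ifs_word r b v 0 - ifs_word r b w 0\<bar> < r ^ n"
      using rn by (simp add: abs_divide)
    with left_endpoints_separated[of v n w] vw show False by auto
  qed
  moreover have "?f ` ?B \<subseteq> {..<3}"
  proof
    fix k assume "k \<in> ?f ` ?B"
    then obtain w where w: "w \<in> ?B" "k = ?f w" by blast
    have "(ifs_word r b w 0 - x + 2 * r ^ n) / r ^ n < 3"
      using range[OF w(1)] rn by (simp add: field_simps)
    then have "\<lfloor>(ifs_word r b w 0 - x + 2 * r ^ n) / r ^ n\<rfloor> < 3" by (simp add: floor_less_iff)
    then have "?f w < 3" by linarith
    then show "k \<in> {..<3}" by (simp only: w(2) lessThan_iff)
  qed
  ultimately have "card ?B \<le> card {..<3::nat}"
    by (intro card_inj_on_le) auto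
  then show ?thesis by simp
qed

text \<open>
  The gap condition is closed in the compact product space of binary sequences, and the coding map is
  a uniform limit of functions of finitely many coordinates.
\<close>

lemma compact_gapped_image: "compact (code_proj r b ` {j \<in> binary_seqs. gapped L t j})"
proof (rule compact_continuous_image)
  have cont: "continuous_on S (\<lambda>j. j k)" for S :: "(nat \<Rightarrow> nat) set" and k
    by (rule continuous_on_subset[OF continuous_on_product_coordinates]) simp
  have "uniform_limit binary_seqs (\<lambda>n j. \<Sum>k<n. b (j k) * r ^ k) (\<lambda>j. \<Sum>k. b (j k) * r ^ k) sequentially"
  proof (rule Weierstrass_m_test)
    show "summable (\<lambda>k. r ^ k)"
      using r_pos r_half by (intro summable_geometric) auto
    show "norm (b (j k) * r ^ k) \<le> r ^ k" if "j \<in> binary_seqs" for k j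
      using b_binary_bounds[OF that, of k] r_pos by (simp add: abs_mult mult_le_cancel_right1)
  qed
  moreover have b_cont: "continuous_on UNIV b"
    by (simp add: continuous_on_open_vimage open_discrete)
  have "continuous_on binary_seqs (\<lambda>j. \<Sum>k<n. b (j k) * r ^ k)" for n
    by (intro continuous_intros continuous_on_compose2[OF b_cont cont]) auto
  ultimately have "continuous_on binary_seqs (\<lambda>j. \<Sum>k. b (j k) * r ^ k)"
    by (intro uniform_limit_theorem[of _ "\<lambda>n j. \<Sum>k<n. b (j k) * r ^ k"]) auto
  then have "continuous_on binary_seqs (code_proj r b)"
    by (rule continuous_on_eq) (simp add: code_proj_sum)
  then show "continuous_on {j \<in> binary_seqs. gapped L t j} (code_proj r b)"
    by (rule continuous_on_subset) auto
  have "compactin (product_topology (\<lambda>_. euclidean) UNIV) (PiE UNIV (\<lambda>_. {0, 1::nat}))"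
    by (simp add: compactin_PiE)
  then have "compact binary_seqs"
    by (simp add: euclidean_product_topology binary_seqs_def PiE_UNIV_domain)
  moreover have "closed {j. gapped L t j}"
  proof -
    have one: "open {j :: nat \<Rightarrow> nat. j n = 1}" "closed {j :: nat \<Rightarrow> nat. j n = 1}" for n
    proof -
      have "open ((\<lambda>j :: nat \<Rightarrow> nat. j n) -` {1})" "closed ((\<lambda>j :: nat \<Rightarrow> nat. j n) -` {1})"
        by (intro open_vimage open_discrete closed_vimage closed_singleton cont)+
      then show "open {j :: nat \<Rightarrow> nat. j n = 1}" "closed {j :: nat \<Rightarrow> nat. j n = 1}"
        by (simp_all add: vimage_def)
    qed
    show ?thesis unfolding gapped_def
      by (intro closed_Collect_all closed_Collect_imp closed_Collect_conj closed_Collect_const open_Collect_const one)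
  qed
  ultimately show "compact {j \<in> binary_seqs. gapped L t j}"
    using compact_Int_closed[of binary_seqs "{j. gapped L t j}"] by (simp add: Int_def)
qed

end

lemma ex_power_bracket:
  fixes r e :: real
  assumes "0 < r" "r < 1" "0 < e" "e < 1"
  shows "\<exists>n. r ^ Suc n \<le> e \<and> e < r ^ n"
proof -
  define k where "k = (LEAST k. r ^ k \<le> e)"
  obtain i where "r ^ i < e" using real_arch_pow_inv[OF assms(3,2)] by blast
  then have "r ^ i \<le> e" by simp
  then have k: "r ^ k \<le> e" unfolding k_def by (rule LeastI)
  then have "k \<noteq> 0" using assms(4) by (cases k) auto
  then obtain n where n: "k = Suc n" by (cases k) auto
  then have "\<not> r ^ n \<le> e" using not_less_Least[of n "\<lambda>k. r ^ k \<le> e"] by (simp add: k_def)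
  with k n show ?thesis by auto
qed

context two_map_ifs
begin

lemma finite_cylinders_cover:
  assumes q: "0 < q" "q + q ^ Suc L = 1"
  shows "code_proj r b ` {j \<in> binary_seqs. gapped L L j}
    \<subseteq> (\<Union>w\<in>{w \<in> binary_words n. gap_mass L q L w \<noteq> 0}. ifs_word r b w ` {0..1})"
proof
  fix x assume "x \<in> code_proj r b ` {j \<in> binary_seqs. gapped L L j}"
  then obtain j where j: "j \<in> binary_seqs" "gapped L L j" "x = code_proj r b j" by blast
  then have "map j [0..<n] \<in> {w \<in> binary_words n. gap_mass L q L w \<noteq> 0}"
    using gap_mass_prefix_pos[OF q j(1,2), of n] prefix_in_binary_words[OF j(1), of n] by simp
  moreover have "x \<in> ifs_word r b (map j [0..<n]) ` {0..1}"
    using code_proj_in_cylinder[OF j(1), of n] j(3) by (simp only:)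
  ultimately show "x \<in> (\<Union>w\<in>{w \<in> binary_words n. gap_mass L q L w \<noteq> 0}. ifs_word r b w ` {0..1})"
    by (rule UN_I)
qed

lemma bounded_cylinder: "bounded (ifs_word r b w ` {0..1})"
  unfolding bounded_two_points
proof (intro exI ballI)
  fix x y assume "x \<in> ifs_word r b w ` {0..1}" "y \<in> ifs_word r b w ` {0..1}"
  then show "dist x y \<le> r ^ length w"
    unfolding dist_real_def by (rule cylinder_dist)
qed

lemma diameter_cylinder_le: "diameter (ifs_word r b w ` {0..1}) \<le> r ^ length w"
proof (rule diameter_le)
  show "norm (x - y) \<le> r ^ length w"
    if "x \<in> ifs_word r b w ` {0..1}" "y \<in> ifs_word r b w ` {0..1}" for x y
    using cylinder_dist[OF that] by simp
qed (use r_pos in simp)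

text \<open>
  At level \<open>n\<close> at most \<open>q\<^bsup>-n\<^esup>\<close> cylinders of length \<open>r\<^sup>n\<close> are needed, and \<open>q\<^bsup>-n\<^esup> r\<^bsup>ns\<^esup>\<close> is the \<open>n\<close>-th
  power of \<open>r\<^bsup>s-d\<^esup> < 1\<close>.
\<close>

lemma hausdorff_measure_gapped_zero:
  assumes q: "0 < q" "q + q ^ Suc L = 1" and d: "0 < d" "r powr d = q" "d < s"
  shows "hausdorff_measure s (code_proj r b ` {j \<in> binary_seqs. gapped L L j}) = 0"
proof -
  let ?F = "code_proj r b ` {j \<in> binary_seqs. gapped L L j}"
  let ?W = "\<lambda>n. {w \<in> binary_words n. gap_mass L q L w \<noteq> 0}"
  have r1: "r < 1" using r_half by simp
  have "hausdorff_premeasure \<delta> s ?F \<le> 0" if \<delta>: "0 < \<delta>" for \<delta>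
  proof (rule ennreal_le_epsilon)
    fix \<epsilon> :: real assume \<epsilon>: "0 < \<epsilon>"
    define u where "u = r powr (s - d)"
    have u: "0 < u" "u < 1"
      using r_pos r1 d by (auto simp: u_def powr01_less_one)
    have "(\<lambda>n. r ^ n) \<longlonglongrightarrow> 0" "(\<lambda>n. u ^ n) \<longlonglongrightarrow> 0"
      using r_pos r1 u by (auto intro!: LIMSEQ_realpow_zero)
    then have "eventually (\<lambda>n. r ^ n < \<delta> \<and> u ^ n < \<epsilon>) sequentially"
      using \<delta> \<epsilon> by (intro eventually_conj order_tendstoD(2))
    then obtain n where n: "r ^ n < \<delta>" "u ^ n < \<epsilon>"
      by (auto simp: eventually_sequentially)
    have len: "length w = n" if "w \<in> ?W n" for w using that by (simp add: binary_words_def)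
    have "(r ^ n) powr s = q ^ n * u ^ n"
    proof -
      have "(r ^ n) powr s = (r powr s) ^ n"
        using r_pos by (simp add: powr_realpow[symmetric] powr_powr mult.commute)
      also have "r powr s = r powr d * u" by (simp add: u_def powr_add[symmetric])
      finally show ?thesis using d by (simp add: power_mult_distrib)
    qed
    moreover have "(\<Sum>w\<in>?W n. diameter (ifs_word r b w ` {0..1}) powr s) \<le> (\<Sum>w\<in>?W n. (r ^ n) powr s)"
    proof (intro sum_mono powr_mono2)
      fix w assume "w \<in> ?W n"
      then show "diameter (ifs_word r b w ` {0..1}) \<le> r ^ n" using diameter_cylinder_le[of w] len by simp
      show "0 \<le> diameter (ifs_word r b w ` {0..1})" by (intro diameter_ge_0 bounded_cylinder)
      show "0 \<le> s" using d by simp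
    qed
    ultimately have "(\<Sum>w\<in>?W n. diameter (ifs_word r b w ` {0..1}) powr s) \<le> card (?W n) * q ^ n * u ^ n"
      by simp
    also have "\<dots> \<le> 1 * u ^ n"
      using card_positive_gap_mass[OF q, of n] u by (intro mult_right_mono) auto
    also have "\<dots> \<le> \<epsilon>" using n by simp
    finally have le: "(\<Sum>w\<in>?W n. diameter (ifs_word r b w ` {0..1}) powr s) \<le> \<epsilon>" .
    have "hausdorff_premeasure \<delta> s ?F \<le> ennreal (\<Sum>w\<in>?W n. diameter (ifs_word r b w ` {0..1}) powr s)"
    proof (rule hausdorff_premeasure_le_finite_cover)
      show "?F \<subseteq> (\<Union>w\<in>?W n. ifs_word r b w ` {0..1})"
        by (rule finite_cylinders_cover[OF q])
      fix w assume "w \<in> ?W n"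
      then show "bounded (ifs_word r b w ` {0..1}) \<and> diameter (ifs_word r b w ` {0..1}) \<le> \<delta>"
        using diameter_cylinder_le[of w] len n(1) bounded_cylinder by auto
    qed (use d \<delta> finite_binary_words in auto)
    also have "\<dots> \<le> ennreal \<epsilon>" by (rule ennreal_leI[OF le])
    finally show "hausdorff_premeasure \<delta> s ?F \<le> 0 + ennreal \<epsilon>" by simp
  qed
  then show ?thesis
    unfolding hausdorff_measure_def by (intro antisym SUP_least) auto
qed

text \<open>
  Choose \<open>n\<close> with \<open>r\<^bsup>n+1\<^esup> \<le> e < r\<^sup>n\<close>.  A level-\<open>N\<close> cylinder that meets the ball sits inside one of at most
  three level-\<open>n\<close> cylinders, each of mass at most \<open>q\<^sup>n\<close>; the factor \<open>1 / q\<close> pays for passing from \<open>r\<^sup>n\<close>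
  to \<open>r\<^bsup>n+1\<^esup>\<close>.
\<close>

lemma mass_meeting_ball_le:
  assumes q: "0 < q" "q + q ^ Suc L = 1" and d: "0 < d" "r powr d = q"
    and e: "0 < e" "r ^ N \<le> e"
  shows "(\<Sum>w | w \<in> binary_words N \<and> ifs_word r b w ` {0..1} \<inter> ball x e \<noteq> {}. gap_mass L q L w)
    \<le> 3 / q * e powr d"
proof (cases "e < 1")
  case False
  have "(\<Sum>w | w \<in> binary_words N \<and> ifs_word r b w ` {0..1} \<inter> ball x e \<noteq> {}. gap_mass L q L w)
      \<le> (\<Sum>w\<in>binary_words N. gap_mass L q L w)"
    using gap_mass_nonneg[OF q] by (intro sum_mono2) (auto simp: finite_binary_words)
  also have "\<dots> = q ^ L" by (rule sum_gap_mass[OF q])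
  also have "\<dots> \<le> 1" using q q_less_1[OF q] by (simp add: power_le_one)
  also have "1 \<le> 3 / q" using q_less_1[OF q] q by simp
  also have "\<dots> \<le> 3 / q * e powr d"
    using mult_left_mono[of 1 "e powr d" "3 / q"] False d q ge_one_powr_ge_zero[of e d] by simp
  finally show ?thesis .
next
  case True
  have r1: "r < 1" using r_half by simp
  obtain n where n: "r ^ Suc n \<le> e" "e < r ^ n"
    using ex_power_bracket[OF r_pos r1 e(1) True] by blast
  have "n < N"
  proof (rule ccontr)
    assume "\<not> n < N"
    then have "r ^ n \<le> r ^ N" using r_pos r1 by (intro power_decreasing) auto
    with n e show False by simp
  qed
  then obtain k where N: "N = n + k" by (metis less_imp_add_positive)
  let ?meets = "\<lambda>w. ifs_word r b w ` {0..1} \<inter> ball x e \<noteq> {}"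
  let ?B = "{v \<in> binary_words n. ?meets v}"
  let ?app = "\<lambda>(v, u). v @ u :: nat list"
  have sub: "{w. w \<in> binary_words N \<and> ?meets w} \<subseteq> ?app ` (?B \<times> binary_words k)"
  proof
    fix w assume w: "w \<in> {w. w \<in> binary_words N \<and> ?meets w}"
    define v u where "v = take n w" and "u = drop n w"
    have wvu: "w = v @ u" by (simp add: v_def u_def)
    have vu: "v \<in> binary_words n" "u \<in> binary_words k"
      using w set_take_subset[of n w] set_drop_subset[of n w]
      by (auto simp: binary_words_def v_def u_def N)
    have "ifs_word r b w ` {0..1} \<subseteq> ifs_word r b v ` {0..1}"
      using ifs_word_in_unit[of u] vu(2) unfolding wvu ifs_word_append
      by (auto simp: binary_words_def)
    with w have "?meets v" by auto
    with vu wvu show "w \<in> ?app ` (?B \<times> binary_words k)" by force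
  qed
  have inj: "inj_on ?app (?B \<times> binary_words k)"
    by (auto simp: inj_on_def binary_words_def)
  have finB: "finite ?B" using finite_binary_words by simp
  have "(\<Sum>w | w \<in> binary_words N \<and> ?meets w. gap_mass L q L w)
      \<le> (\<Sum>w\<in>?app ` (?B \<times> binary_words k). gap_mass L q L w)"
    using sub finB finite_binary_words gap_mass_nonneg[OF q] by (intro sum_mono2) auto
  also have "\<dots> = (\<Sum>v\<in>?B. \<Sum>u\<in>binary_words k. gap_mass L q L (v @ u))"
    unfolding sum.reindex[OF inj] sum.cartesian_product by (simp add: case_prod_unfold)
  also have "\<dots> = (\<Sum>v\<in>?B. gap_mass L q L v)"
    by (simp add: sum_gap_mass_append[OF q])
  also have "\<dots> \<le> (\<Sum>v\<in>?B. q ^ n)"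
    using gap_mass_le[OF q] by (intro sum_mono) (metis (mono_tags, lifting) binary_words_def mem_Collect_eq)
  also have "\<dots> = card ?B * q ^ n" by simp
  also have "\<dots> \<le> 3 * q ^ n"
    using card_cylinders_meeting_ball[of e n x] n q by (intro mult_right_mono) auto
  also have "\<dots> = 3 / q * q ^ Suc n" using q by simp
  also have "q ^ Suc n = (r ^ Suc n) powr d"
    using r_pos by (simp only: d(2)[symmetric] powr_realpow[symmetric] powr_gt_zero powr_powr mult.commute)
  also have "3 / q * (r ^ Suc n) powr d \<le> 3 / q * e powr d"
    using n r_pos d q by (intro mult_left_mono powr_mono2) auto
  finally show ?thesis .
qed

text \<open>
  Each word of positive weight is a prefix of a gapped sequence, whose coding lies in some ball of the
  cover.  At a level finer than every radius, the masses met by the balls therefore add up to at least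
  the total mass \<open>q\<^sup>L\<close>.
\<close>

lemma hausdorff_measure_gapped_nonzero:
  assumes q: "0 < q" "q + q ^ Suc L = 1" and d: "0 < d" "r powr d = q" and s: "0 \<le> s" "s \<le> d"
  shows "hausdorff_measure s (code_proj r b ` {j \<in> binary_seqs. gapped L L j}) \<noteq> 0"
proof -
  let ?F = "code_proj r b ` {j \<in> binary_seqs. gapped L L j}"
  have "ennreal (q ^ L / (2 * (3 / q))) \<le> hausdorff_premeasure 1 s ?F"
  proof (rule hausdorff_premeasure_ge_of_ball_covers[OF compact_gapped_image d(1) s])
    show "0 < 3 / q" "0 < q ^ L" using q by auto
    fix I :: "nat set" and x e
    assume fin: "finite I" and e: "\<And>n. n \<in> I \<Longrightarrow> 0 < e n"
      and cov: "?F \<subseteq> (\<Union>n\<in>I. ball (x n) (e n))"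
    have "eventually (\<lambda>N. \<forall>n\<in>I. r ^ N < e n) sequentially"
    proof (intro eventually_ball_finite fin ballI)
      fix n assume "n \<in> I"
      have "(\<lambda>n. r ^ n) \<longlonglongrightarrow> 0"
        using r_pos r_half by (intro LIMSEQ_realpow_zero) auto
      then show "eventually (\<lambda>N. r ^ N < e n) sequentially"
        using e[OF \<open>n \<in> I\<close>] by (rule order_tendstoD(2))
    qed
    then obtain N where N: "\<And>n. n \<in> I \<Longrightarrow> r ^ N < e n"
      by (auto simp: eventually_sequentially)
    let ?meets = "\<lambda>n w. ifs_word r b w ` {0..1} \<inter> ball (x n) (e n) \<noteq> {}"
    let ?M = "gap_mass L q L"
    have cover_w: "?M w \<le> (\<Sum>n\<in>I. if ?meets n w then ?M w else 0)" if w: "w \<in> binary_words N" for w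
    proof (cases "?M w = 0")
      case False
      obtain j where j: "j \<in> binary_seqs" "gapped L L j" "map j [0..<length w] = w"
        using gap_mass_pos_extends[OF q _ False] w by (auto simp: binary_words_def)
      then obtain n where n: "n \<in> I" "code_proj r b j \<in> ball (x n) (e n)"
        using cov by blast
      with code_proj_in_cylinder[OF j(1), of "length w"] j(3) have "?meets n w" by auto
      then have "?M w = (if ?meets n w then ?M w else 0)" by simp
      also have "\<dots> \<le> (\<Sum>n\<in>I. if ?meets n w then ?M w else 0)"
        using gap_mass_nonneg[OF q] by (intro member_le_sum n fin) auto
      finally show ?thesis .
    qed (simp add: sum_nonneg)
    have "q ^ L = (\<Sum>w\<in>binary_words N. ?M w)"
      by (rule sum_gap_mass[OF q, symmetric])
    also have "\<dots> \<le> (\<Sum>w\<in>binary_words N. \<Sum>n\<in>I. if ?meets n w then ?M w else 0)"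
      by (intro sum_mono cover_w)
    also have "\<dots> = (\<Sum>n\<in>I. \<Sum>w\<in>binary_words N. if ?meets n w then ?M w else 0)"
      by (rule sum.swap)
    also have "\<dots> = (\<Sum>n\<in>I. \<Sum>w | w \<in> binary_words N \<and> ?meets n w. ?M w)"
      by (simp only: sum.inter_filter[OF finite_binary_words])
    also have "\<dots> \<le> (\<Sum>n\<in>I. 3 / q * e n powr d)"
      using e N by (intro sum_mono mass_meeting_ball_le[OF q d]) (auto intro: less_imp_le)
    also have "\<dots> = 3 / q * (\<Sum>n\<in>I. e n powr d)"
      by (rule sum_distrib_left[symmetric])
    finally show "q ^ L \<le> 3 / q * (\<Sum>n\<in>I. e n powr d)" .
  qed
  also have "\<dots> \<le> hausdorff_measure s ?F"
    unfolding hausdorff_measure_def by (intro SUP_upper) auto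
  finally have "ennreal (q ^ L / (2 * (3 / q))) \<le> hausdorff_measure s ?F" .
  moreover have "0 < ennreal (q ^ L / (2 * (3 / q)))" using q by (simp add: ennreal_zero_less_divide)
  ultimately show ?thesis by auto
qed

lemma hausdorff_dim_gapped:
  assumes "1 \<le> L"
  shows "hausdorff_dim (code_proj r b ` {j \<in> binary_seqs. gapped L L j})
    = ereal (ln (gap_root L) / (- ln r))"
proof -
  define \<rho> where "\<rho> = gap_root L"
  define d where "d = ln \<rho> / (- ln r)"
  define q where "q = 1 / \<rho>"
  note \<rho> = gap_root_props[OF assms, folded \<rho>_def]
  have lnr: "ln r < 0" using r_pos r_half by simp
  have d: "0 < d" using \<rho>(1) lnr by (simp add: d_def divide_pos_neg zero_less_divide_iff)
  have rd: "r powr d = q"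
    using r_pos \<rho>(1) lnr by (simp add: powr_def d_def q_def exp_minus inverse_eq_divide)
  have q: "0 < q" "q + q ^ Suc L = 1"
  proof -
    show "0 < q" using \<rho>(1) by (simp add: q_def)
    have "\<rho> ^ Suc L * (q + q ^ Suc L) = \<rho> ^ Suc L * 1"
      using \<rho>(1,3) by (simp add: q_def power_one_over field_simps)
    then show "q + q ^ Suc L = 1" using \<rho>(1) by (simp only: mult_cancel_left) simp
  qed
  have "hausdorff_dim (code_proj r b ` {j \<in> binary_seqs. gapped L L j}) = ereal d"
    using hausdorff_measure_gapped_zero[OF q d rd] hausdorff_measure_gapped_nonzero[OF q d rd]
    by (intro hausdorff_dim_eqI d) auto
  then show ?thesis by (simp add: d_def \<rho>_def)
qed

end

section \<open>The preimage and the dimension of the tree fractal\<close>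

theorem proposition6p1:
  fixes r :: real and b :: "nat \<Rightarrow> real" and m L :: nat
  assumes "0 < r" and "r \<le> 1 / 2"
    and "unit_interval_ifs r b"
    and "m \<ge> 3"
    and "m \<in> {2 ^ (L + 1) - 1 .. 2 ^ (L + 2) - 2}"
  shows "(r < 1 / 2 \<longrightarrow>
            {j \<in> binary_seqs. code_proj r b j \<in> tree_fractal r b m} =
            {j \<in> gap_shift L. \<forall>k < L. j k = 0}) \<and>
         (r = 1 / 2 \<longrightarrow>
            {j \<in> binary_seqs. code_proj r b j \<in> tree_fractal r b m} =
            {j \<in> gap_shift L. \<forall>k < L. j k = 0} \<union>
            {j. \<exists>j' \<in> {j \<in> gap_shift L. \<forall>k < L. j k = 0}. dyadic_twin j' j}) \<and>
         hausdorff_dim (tree_fractal r b m) = ereal (ln (gap_root L) / (- ln r))"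
proof -
  interpret two_map_ifs r b
    using assms by unfold_locales
  have "1 < (2::nat) ^ (L + 2)" by (rule one_less_power) auto
  then have m: "2 ^ (L + 1) \<le> m + 1" "m + 1 < 2 ^ (L + 2)"
    using assms(4,5) unfolding atLeastAtMost_iff by linarith+
  have "1 \<le> L"
    using m assms(4) by (cases L) auto
  define S where "S = {j \<in> binary_seqs. gapped L L j}"
  have shift: "{j \<in> gap_shift L. \<forall>k < L. j k = 0} = S"
    unfolding S_def by (rule initially_zero_gap_shift)
  have F: "tree_fractal r b m = code_proj r b ` S"
    unfolding S_def by (rule tree_fractal_eq_image[OF assms(4) m])
  have S: "S \<subseteq> binary_seqs" by (auto simp: S_def)
  have zeros: "\<exists>k>i. j k = 0" if "j \<in> S" for j i
  proof -
    have bin: "j (i + 1) = 0 \<or> j (i + 1) = 1" "j (i + 2) = 0 \<or> j (i + 2) = 1"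
      using that by (auto simp: S_def binary_seqs_iff)
    have "\<not> (j (i + 1) = 1 \<and> j (i + 2) = 1)"
    proof
      assume "j (i + 1) = 1 \<and> j (i + 2) = 1"
      then have "i + 1 + L < i + 2"
        using gap_shift_separation[of j L "i + 1" "i + 2"] gapped_imp_gap_shift[of j L L] that
        by (simp add: S_def)
      with \<open>1 \<le> L\<close> show False by simp
    qed
    with bin have "j (i + 1) = 0 \<or> j (i + 2) = 0" by auto
    moreover have "i < i + 1" "i < i + 2" by auto
    ultimately show ?thesis by blast
  qed
  show ?thesis
    unfolding shift F
    using code_proj_vimage[OF S zeros] hausdorff_dim_gapped[OF \<open>1 \<le> L\<close>, folded S_def] by blast
qed

end
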